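(* Let $n\ge2$, $r\ge1$, and let $a_1\ge a_2\ge\dots\ge a_r\ge0$ be integers with $\sum_k a_k=n$; write $a=(a_1,\dots,a_r)$. Let $$M=\frac{(n-2)!}{a_1!\cdots a_r!}\sum_{1\le i<j\le r}a_ia_j,\qquad I=\Big\{i\in\{1,\dots,r\}:\ \binom{n-2}{a_1,\dots,a_i-2,\dots,a_r}\text{ is odd}\Big\},\qquad m=|I|.$$ 1. If $I=\emptyset$ (that is, $\binom{n-2}{a_1,\dots,a_k-2,\dots,a_r}$ is even for all $k\in\{1,\dots,r\}$), then $A_1(a)=\prod_{k=1}^rA(a_k)$ if $M$ is odd, and $A_1(a)=0$ if $M$ is even. 2. If $m\ge1$, then $$A_1(a)=\sum_{i\in I}B(a_i)\prod_{k=1,\,k\ne i}^rA(a_k)-\frac{m-1}{2}\prod_{k=1}^rA(a_k).$$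
   Context: Multinomial coefficients with a negative lower entry are $0$. For a partition $\mu$ of $m'$, $f_\mu$ and $\chi_\mu$ are the dimension and character of the irreducible complex representation $\rho_\mu$ of $S_{m'}$ indexed by $\mu$; $g_\mu=\frac{f_\mu-\chi_\mu(s_1)}2$ with $s_1=(1\,2)$ if $m'\ge2$, and $g_\mu=0$ if $m'<2$. $A(m')$ is the number of partitions $\mu$ of $m'$ with $f_\mu$ odd. $B(m')$ is the number of chiral partitions $\mu$ of $m'$, i.e. those for which $\det\circ\rho_\mu$ is nontrivial (equivalently, is the sign character). For an $r$-tuple $\lambda=(\lambda_1,\dots,\lambda_r)$ of partitions with $|\lambda_k|=a_k$, put $\widehat f_{\lambda_k}=\prod_{j\ne k}f_{\lambda_j}$ and $$y_\lambda=f_{\lambda_1}\cdots f_{\lambda_r}\frac{(n-2)!}{a_1!\cdots a_r!}\sum_{1\le i<j\le r}a_ia_j+\sum_{k=1}^r g_{\lambda_k}\widehat f_{\lambda_k}\binom{n-2}{a_1,\dots,a_k-2,\dots,a_r}.$$ $A_1(a)$ is the number of $r$-tuples $\lambda=(\lambda_1,\dots,\lambda_r)$ of partitions with $|\lambda_k|=a_k$ for all $k$ and $y_\lambda$ odd. *)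

theory Defs
  imports
    "HOL-Algebra.Sym_Groups"
    "HOL-Library.Function_Algebras"
    "HOL-Library.Indicator_Function"
    "Jordan_Normal_Form.Determinant"
begin

subsection \<open>Group algebras\<close>

definition fscale :: "complex \<Rightarrow> ('g \<Rightarrow> complex) \<Rightarrow> 'g \<Rightarrow> complex"
  where "fscale c x = (\<lambda>g. c * x g)"

global_interpretation galg: vector_space fscale
  by standard (auto simp: fscale_def fun_eq_iff algebra_simps)

text \<open>
  The complex group algebra of a finite group is modelled by the complex-valued functions
  that vanish outside of the carrier, with convolution as multiplication; the group element
  \<open>g\<close> corresponds to \<^term>\<open>indicator {g}\<close>.
\<close>

definition group_algebra :: "('g, 'b) monoid_scheme \<Rightarrow> ('g \<Rightarrow> complex) set"
  where "group_algebra G = {x. \<forall>g. g \<notin> carrier G \<longrightarrow> x g = 0}"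

definition conv ::
    "('g, 'b) monoid_scheme \<Rightarrow> ('g \<Rightarrow> complex) \<Rightarrow> ('g \<Rightarrow> complex) \<Rightarrow> 'g \<Rightarrow> complex"
  where "conv G x y =
    (\<lambda>g. if g \<in> carrier G
         then (\<Sum>h\<in>carrier G. x h * y (inv\<^bsub>G\<^esub> h \<otimes>\<^bsub>G\<^esub> g)) else 0)"


subsection \<open>Partitions and their irreducible representations\<close>

definition partitions_of :: "nat \<Rightarrow> nat list set"
  where "partitions_of n = {\<mu>. sorted_wrt (\<ge>) \<mu> \<and> (\<forall>p\<in>set \<mu>. p > 0) \<and> sum_list \<mu> = n}"

text \<open>
  Row and column (counted from \<open>0\<close> and \<open>1\<close>, respectively) of the entry \<open>k\<close> in the tableau of
  shape \<open>\<mu>\<close> whose rows are filled consecutively with \<open>1, 2, \<dots>, |\<mu>|\<close>.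
\<close>

definition tab_row :: "nat list \<Rightarrow> nat \<Rightarrow> nat"
  where "tab_row \<mu> k = (LEAST i. k \<le> sum_list (take (Suc i) \<mu>))"

definition tab_col :: "nat list \<Rightarrow> nat \<Rightarrow> nat"
  where "tab_col \<mu> k = k - sum_list (take (tab_row \<mu> k) \<mu>)"

definition row_group :: "nat list \<Rightarrow> (nat \<Rightarrow> nat) set"
  where "row_group \<mu> = {p \<in> carrier (sym_group (sum_list \<mu>)).
    \<forall>k\<in>{1..sum_list \<mu>}. tab_row \<mu> (p k) = tab_row \<mu> k}"

definition col_group :: "nat list \<Rightarrow> (nat \<Rightarrow> nat) set"
  where "col_group \<mu> = {p \<in> carrier (sym_group (sum_list \<mu>)).
    \<forall>k\<in>{1..sum_list \<mu>}. tab_col \<mu> (p k) = tab_col \<mu> k}"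

definition young_symmetrizer :: "nat list \<Rightarrow> (nat \<Rightarrow> nat) \<Rightarrow> complex"
  where "young_symmetrizer \<mu> = conv (sym_group (sum_list \<mu>))
    (indicator (row_group \<mu>))
    (\<lambda>p. if p \<in> col_group \<mu> then of_int (sign p) else 0)"

text \<open>
  The irreducible representation indexed by \<open>\<mu>\<close> is the left ideal generated by the Young
  symmetrizer, on which the symmetric group acts by left multiplication.  With this convention
  \<open>[n]\<close> indexes the trivial and \<open>[1, \<dots>, 1]\<close> the sign representation.
\<close>

definition specht_module :: "nat list \<Rightarrow> ((nat \<Rightarrow> nat) \<Rightarrow> complex) set"
  where "specht_module \<mu> = (\<lambda>x. conv (sym_group (sum_list \<mu>)) x (young_symmetrizer \<mu>)) `
    group_algebra (sym_group (sum_list \<mu>))"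

text \<open>
  The operators are represented by matrices with respect to an arbitrary fixed basis of the
  module; dimension, trace and determinant do not depend on its choice.
\<close>

definition specht_basis :: "nat list \<Rightarrow> ((nat \<Rightarrow> nat) \<Rightarrow> complex) list"
  where "specht_basis \<mu> = (SOME bs. distinct bs \<and> galg.independent (set bs) \<and>
    galg.span (set bs) = specht_module \<mu>)"

definition irrep :: "nat list \<Rightarrow> (nat \<Rightarrow> nat) \<Rightarrow> complex mat"
  where "irrep \<mu> \<sigma> = (let bs = specht_basis \<mu> in
    mat (length bs) (length bs) (\<lambda>(i, j). galg.representation (set bs)
      (conv (sym_group (sum_list \<mu>)) (indicator {\<sigma>}) (bs ! j)) (bs ! i)))"

definition irrep_dim :: "nat list \<Rightarrow> nat"
  where "irrep_dim \<mu> = galg.dim (specht_module \<mu>)"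

definition irrep_char :: "nat list \<Rightarrow> (nat \<Rightarrow> nat) \<Rightarrow> complex"
  where "irrep_char \<mu> \<sigma> = sum_list (diag_mat (irrep \<mu> \<sigma>))"

definition irrep_g :: "nat list \<Rightarrow> complex"
  where "irrep_g \<mu> = (if sum_list \<mu> \<ge> 2
    then (of_nat (irrep_dim \<mu>) - irrep_char \<mu> (transpose 1 2)) / 2 else 0)"

definition chiral :: "nat list \<Rightarrow> bool"
  where "chiral \<mu> \<longleftrightarrow> (\<exists>\<sigma>\<in>carrier (sym_group (sum_list \<mu>)). det (irrep \<mu> \<sigma>) \<noteq> 1)"


subsection \<open>Counting functions\<close>

definition num_odd :: "nat \<Rightarrow> nat"
  where "num_odd n = card {\<mu> \<in> partitions_of n. odd (irrep_dim \<mu>)}"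

definition num_chiral :: "nat \<Rightarrow> nat"
  where "num_chiral n = card {\<mu> \<in> partitions_of n. chiral \<mu>}"

text \<open>
  The lower entries are meant to sum up to \<open>N\<close>, in which case the division is exact.
\<close>

definition multinomial :: "nat \<Rightarrow> int list \<Rightarrow> nat"
  where "multinomial N ks = (if \<exists>k\<in>set ks. k < 0 then 0
    else fact N div prod_list (map (\<lambda>k. fact (nat k)) ks))"

definition lowered_multinomial :: "nat list \<Rightarrow> nat \<Rightarrow> nat"
  where "lowered_multinomial a k =
    multinomial (sum_list a - 2) ((map int a)[k := int (a ! k) - 2])"

definition coeff_M :: "nat list \<Rightarrow> complex"
  where "coeff_M a = fact (sum_list a - 2) / (\<Prod>k<length a. fact (a ! k)) *
    (\<Sum>(i, j) \<in> {(i, j). i < j \<and> j < length a}. of_nat (a ! i) * of_nat (a ! j))"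

definition y_val :: "nat list \<Rightarrow> nat list list \<Rightarrow> complex"
  where "y_val a ls =
    (\<Prod>k<length a. of_nat (irrep_dim (ls ! k))) * coeff_M a +
    (\<Sum>k<length a. irrep_g (ls ! k) *
      (\<Prod>j\<in>{..<length a} - {k}. of_nat (irrep_dim (ls ! j))) *
      of_nat (lowered_multinomial a k))"

text \<open>
  Parity of numbers that are given by a formula in a field but happen to be integers.
\<close>

definition is_odd :: "'a :: ring_1 \<Rightarrow> bool"
  where "is_odd x \<longleftrightarrow> (\<exists>k::int. odd k \<and> x = of_int k)"

definition is_even :: "'a :: ring_1 \<Rightarrow> bool"
  where "is_even x \<longleftrightarrow> (\<exists>k::int. even k \<and> x = of_int k)"

definition num_y_odd :: "nat list \<Rightarrow> nat"
  where "num_y_odd a = card {ls. length ls = length a \<and>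
    (\<forall>k<length a. ls ! k \<in> partitions_of (a ! k)) \<and> is_odd (y_val a ls)}"

end

theory Submission
  imports Defs "Jordan_Normal_Form.Schur_Decomposition"
begin

text \<open>
  The transposition \<open>s\<^sub>1\<close> acts as an involution, so \<open>g\<^sub>\<mu>\<close> is the multiplicity of its eigenvalue
  \<open>-1\<close>, and \<open>\<mu>\<close> is chiral iff \<open>g\<^sub>\<mu>\<close> is odd, all transpositions being conjugate.  Conjugating a
  partition tensors its representation with the sign; this preserves \<open>f\<^sub>\<mu>\<close> and turns \<open>g\<^sub>\<mu>\<close> into
  \<open>f\<^sub>\<mu> - g\<^sub>\<mu>\<close>.  Hence for size at least 2, exactly half of the partitions with \<open>f\<^sub>\<mu>\<close> odd have \<open>g\<^sub>\<mu>\<close>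
  odd.  Modulo 2, \<open>y\<^sub>\<lambda>\<close> can be odd only if at most one \<open>f\<close> is even.  If the even one is at
  position \<open>i\<close>, then \<open>y\<^sub>\<lambda>\<close> is odd iff \<open>i \<in> I\<close> and the corresponding \<open>g\<close> is odd.  If all \<open>f\<close> are
  odd, then \<open>y\<^sub>\<lambda> \<equiv> M + \<Sum>\<^sub>i\<^sub>\<in>\<^sub>I g\<close>, whose parity is flipped by conjugating the partition at a
  position in \<open>I\<close>; so, if \<open>I \<noteq> \<emptyset>\<close>, half of these tuples count, whatever the parity of \<open>M\<close>.
\<close>

subsection \<open>Traces and matrices of linear maps\<close>

definition mat_trace :: "'a::comm_ring_1 mat \<Rightarrow> 'a" where
  "mat_trace A = sum_list (diag_mat A)"

lemma mat_trace_eq: "mat_trace A = (\<Sum>i<dim_row A. A $$ (i, i))"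
  by (simp add: mat_trace_def diag_mat_def interv_sum_list_conv_sum_set_nat atLeast0LessThan)

lemma mat_trace_mult_commute:
  assumes "A \<in> carrier_mat m n" "B \<in> carrier_mat n m"
  shows "mat_trace (A * B) = mat_trace (B * A)"
proof -
  have "mat_trace (A * B) = (\<Sum>i<m. \<Sum>j<n. A $$ (i, j) * B $$ (j, i))"
    using assms by (simp add: mat_trace_eq scalar_prod_def atLeast0LessThan)
  also have "\<dots> = (\<Sum>j<n. \<Sum>i<m. B $$ (j, i) * A $$ (i, j))"
    by (subst sum.swap) (simp add: mult.commute)
  also have "\<dots> = mat_trace (B * A)"
    using assms by (simp add: mat_trace_eq scalar_prod_def atLeast0LessThan)
  finally show ?thesis .
qed

lemma mat_trace_similar:
  assumes "similar_mat A B"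
  shows "mat_trace A = mat_trace B"
proof -
  obtain n P Q where c: "A \<in> carrier_mat n n" "B \<in> carrier_mat n n" "P \<in> carrier_mat n n"
      "Q \<in> carrier_mat n n"
    and QP: "Q * P = 1\<^sub>m n" and A: "A = P * B * Q"
    using similar_matD[OF assms] by auto
  have "mat_trace A = mat_trace (Q * (P * B))"
    unfolding A using c by (intro mat_trace_mult_commute[of _ n n]) auto
  also have "Q * (P * B) = B"
    using c QP by (simp flip: assoc_mult_mat[of Q n n P n B n])
  finally show ?thesis .
qed

text \<open>In the diagonal entry of the product, terms with \<open>k < i\<close> vanish through
  \<open>A\<close> and terms with \<open>k > i\<close> through \<open>B\<close>, so only
  \<open>k = i\<close> survives.\<close>

lemma upper_triangular_mult_diag:
  assumes "A \<in> carrier_mat n n" "B \<in> carrier_mat n n" "upper_triangular A" "upper_triangular B" "i < n"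
  shows "(A * B) $$ (i, i) = A $$ (i, i) * (B $$ (i, i) :: 'a::comm_ring_1)"
proof -
  have "(A * B) $$ (i, i) = (\<Sum>k<n. A $$ (i, k) * B $$ (k, i))"
    using assms by (simp add: scalar_prod_def atLeast0LessThan)
  also have "\<dots> = (\<Sum>k<n. if k = i then A $$ (i, i) * B $$ (i, i) else 0)"
  proof (intro sum.cong refl)
    fix k assume "k \<in> {..<n}"
    then show "A $$ (i, k) * B $$ (k, i) = (if k = i then A $$ (i, i) * B $$ (i, i) else 0)"
      using assms(1,2,5) upper_triangularD[OF assms(3), of k i] upper_triangularD[OF assms(4), of i k]
      by (cases k i rule: linorder_cases) auto
  qed
  finally show ?thesis using assms(5) by simp
qed

text \<open>In a triangularisation of an involution all diagonal entries are \<open>1\<close> or \<open>-1\<close>.\<close>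

lemma involution_mat_trace_det:
  fixes A :: "complex mat"
  assumes A: "A \<in> carrier_mat n n" and inv: "A * A = 1\<^sub>m n"
  obtains k :: nat where "k \<le> n" "mat_trace A = of_nat n - 2 * of_nat k" "det A = (-1) ^ k"
proof -
  \<comment> \<open>Complex characteristic polynomials split, so a triangular matrix similar to
    \<open>A\<close> exists; squaring along the similarity gives
    \<open>B * B = 1\<^sub>m n\<close>.\<close>
  obtain B where B: "B \<in> carrier_mat n n" "upper_triangular B" "similar_mat A B"
    using schur_decomposition_exists[OF A] char_poly_factorized[OF A] by blast
  obtain P Q where PQ: "similar_mat_wit A B P Q"
    using B(3) by (auto simp: similar_mat_def)
  have "A ^\<^sub>m 2 = 1\<^sub>m n" using A inv by (simp add: numeral_2_eq_2)
  moreover have "similar_mat_wit (B ^\<^sub>m 2) (A ^\<^sub>m 2) Q P"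
    using similar_mat_wit_pow[OF similar_mat_wit_sym[OF PQ]] by simp
  ultimately have "B ^\<^sub>m 2 = Q * 1\<^sub>m n * P" "Q \<in> carrier_mat n n" "P \<in> carrier_mat n n" "Q * P = 1\<^sub>m n"
    using A B(1) similar_mat_witD[of n "B ^\<^sub>m 2" "A ^\<^sub>m 2" Q P] similar_mat_witD2[OF A PQ]
    by auto
  then have BB: "B * B = 1\<^sub>m n" using B(1) by (simp add: numeral_2_eq_2)
  have pm: "B $$ (i, i) = 1 \<or> B $$ (i, i) = -1" if "i < n" for i
  proof -
    have "B $$ (i, i) * B $$ (i, i) = 1"
      using upper_triangular_mult_diag[OF B(1) B(1) B(2) B(2) that] BB that by simp
    then show ?thesis by (simp add: square_eq_1_iff)
  qed
  \<comment> \<open>The witness \<open>k\<close> will be the size of \<open>N\<close>, the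
    multiplicity of the eigenvalue -1.\<close>
  define N where "N = {i \<in> {..<n}. B $$ (i, i) = -1}"
  have eq: "B $$ (i, i) = (if i \<in> N then -1 else 1)" if "i < n" for i
    using pm[OF that] that by (auto simp: N_def)
  have "finite N" "N \<subseteq> {..<n}" by (auto simp: N_def)
  then have card: "card N \<le> n" using card_mono[of "{..<n}" N] by simp
  have "mat_trace A = (\<Sum>i<n. if i \<in> N then -1 else 1)"
    using mat_trace_similar[OF B(3)] B(1) eq by (simp add: mat_trace_eq)
  also have "\<dots> = (\<Sum>i<n. 1 - 2 * (if i \<in> N then 1 else 0))" by (intro sum.cong) auto
  also have "\<dots> = of_nat n - 2 * (\<Sum>i<n. if i \<in> N then 1 else 0)"
    by (simp add: sum_subtractf flip: sum_distrib_left)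
  also have "(\<Sum>i<n. if i \<in> N then 1 else 0 :: complex) = of_nat (card N)"
    using \<open>N \<subseteq> _\<close> by (simp add: sum.If_cases Int_absorb1)
  finally have tr: "mat_trace A = of_nat n - 2 * of_nat (card N)" .
  have "det A = prod_list (diag_mat B)"
    using det_similar[OF B(3)] det_upper_triangular[OF B(2,1)] by simp
  also have "\<dots> = (\<Prod>i<n. if i \<in> N then -1 else 1)"
    using B(1) eq by (simp add: prod_list_diag_prod atLeast0LessThan)
  also have "\<dots> = (-1) ^ card N"
    using \<open>N \<subseteq> _\<close> by (simp add: prod.If_cases Int_absorb1)
  finally show thesis using that[OF card tr] by simp
qed

section \<open>Coordinates and matrices with respect to listed bases\<close>

definition basis_list :: "('g \<Rightarrow> complex) list \<Rightarrow> ('g \<Rightarrow> complex) set \<Rightarrow> bool" where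
  "basis_list bs V \<longleftrightarrow> distinct bs \<and> galg.independent (set bs) \<and> galg.span (set bs) = V"

text \<open>Columns belong to the source basis \<open>bs\<close>, rows to the target basis
  \<open>cs\<close>. With two bases, a change of basis is a matrix of the identity;
  \<open>irrep\<close> is the case \<open>bs = cs\<close>.\<close>

definition mat_of :: "('g \<Rightarrow> complex) list \<Rightarrow> ('g \<Rightarrow> complex) list \<Rightarrow> (('g \<Rightarrow> complex) \<Rightarrow> ('g \<Rightarrow> complex)) \<Rightarrow> complex mat" where
  "mat_of bs cs T = mat (length cs) (length bs) (\<lambda>(i, j). galg.representation (set cs) (T (bs ! j)) (cs ! i))"

lemma mat_of_carrier [simp]: "mat_of bs cs T \<in> carrier_mat (length cs) (length bs)"
  by (simp add: mat_of_def)

lemma sum_set_nth: "distinct bs \<Longrightarrow> (\<Sum>b\<in>set bs. f b) = (\<Sum>k<length bs. f (bs ! k))"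
  by (rule sum.reindex_bij_betw[symmetric, OF bij_betw_nth]) auto

lemma representation_combination:
  assumes "galg.independent B" "\<And>k. k \<in> K \<Longrightarrow> f k \<in> galg.span B"
  shows "galg.representation B (\<Sum>k\<in>K. fscale (c k) (f k)) b =
    (\<Sum>k\<in>K. c k * galg.representation B (f k) b)"
  using assms by (simp add: galg.representation_sum galg.representation_scale galg.span_scale)

lemma basis_list_expand:
  assumes "basis_list bs V" "v \<in> V"
  shows "v = (\<Sum>k<length bs. fscale (galg.representation (set bs) v (bs ! k)) (bs ! k))"
  using assms galg.sum_representation_eq[of "set bs" v "set bs"]
  by (simp add: basis_list_def sum_set_nth)

text \<open>Expanding \<open>T (bs ! j)\<close> in \<open>cs\<close>, applying \<open>S\<close> and
  comparing coordinates in \<open>ds\<close> yields the matrix product.\<close>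

lemma mat_of_comp:
  assumes cs: "basis_list cs W" and ds: "basis_list ds U"
    and S: "Vector_Spaces.linear fscale fscale S"
    and TW: "\<And>b. b \<in> set bs \<Longrightarrow> T b \<in> W" and SU: "\<And>w. w \<in> W \<Longrightarrow> S w \<in> U"
  shows "mat_of bs ds (\<lambda>x. S (T x)) = mat_of cs ds S * mat_of bs cs T"
proof (rule eq_matI)
  fix i j assume "i < dim_row (mat_of cs ds S * mat_of bs cs T)" "j < dim_col (mat_of cs ds S * mat_of bs cs T)"
  then have i: "i < length ds" and j: "j < length bs" by (auto simp: mat_of_def)
  interpret S: Vector_Spaces.linear fscale fscale S by (rule S)
  let ?r = "\<lambda>k. galg.representation (set cs) (T (bs ! j)) (cs ! k)"
  have csW: "cs ! k \<in> W" if "k < length cs" for k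
    using cs that galg.span_base[of "cs ! k" "set cs"] by (auto simp: basis_list_def)
  have SUcs: "S (cs ! k) \<in> galg.span (set ds)" if "k < length cs" for k
    using ds SU[OF csW[OF that]] by (simp add: basis_list_def)
  have "S (T (bs ! j)) = S (\<Sum>k<length cs. fscale (?r k) (cs ! k))"
    using basis_list_expand[OF cs TW[of "bs ! j"]] j by simp
  also have "\<dots> = (\<Sum>k<length cs. fscale (?r k) (S (cs ! k)))"
    by (simp add: S.sum S.scale)
  finally have "galg.representation (set ds) (S (T (bs ! j))) (ds ! i) =
      (\<Sum>k<length cs. ?r k * galg.representation (set ds) (S (cs ! k)) (ds ! i))"
    using ds SUcs representation_combination[of "set ds" "{..<length cs}" "\<lambda>k. S (cs ! k)"]
    by (simp add: basis_list_def)
  then show "mat_of bs ds (\<lambda>x. S (T x)) $$ (i, j) = (mat_of cs ds S * mat_of bs cs T) $$ (i, j)"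
    using i j by (simp add: mat_of_def scalar_prod_def atLeast0LessThan mult.commute)
qed (auto simp: mat_of_def)

lemma mat_of_id:
  assumes "basis_list bs V" "\<And>b. b \<in> set bs \<Longrightarrow> T b = b"
  shows "mat_of bs bs T = 1\<^sub>m (length bs)"
  using assms by (auto intro!: eq_matI simp: mat_of_def basis_list_def galg.representation_basis nth_eq_iff_index_eq)

text \<open>Both matrices are products of the same two mixed matrices, that of \<open>T\<close> from
  \<open>bs\<close> to \<open>cs\<close> and that of the identity from \<open>cs\<close> to
  \<open>bs\<close>, in opposite orders. The trace is insensitive to the order.\<close>

lemma mat_trace_basis_change:
  assumes bs: "basis_list bs V" and cs: "basis_list cs V"
    and T: "Vector_Spaces.linear fscale fscale T" and TV: "\<And>v. v \<in> V \<Longrightarrow> T v \<in> V"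
  shows "mat_trace (mat_of bs bs T) = mat_trace (mat_of cs cs T)"
proof -
  have bV: "b \<in> V" if "b \<in> set bs" for b
    using bs that by (auto simp: basis_list_def galg.span_base)
  have cV: "b \<in> V" if "b \<in> set cs" for b
    using cs that by (auto simp: basis_list_def galg.span_base)
  have "mat_of bs bs T = mat_of cs bs (\<lambda>x. x) * mat_of bs cs T"
    using mat_of_comp[OF cs bs, of "\<lambda>x. x" bs T] galg.linear_ident TV bV by auto
  moreover have "mat_of cs cs T = mat_of bs cs T * mat_of cs bs (\<lambda>x. x)"
    using mat_of_comp[OF bs cs T, of cs "\<lambda>x. x"] TV cV by auto
  ultimately show ?thesis
    by (simp add: mat_trace_mult_commute[of _ "length bs" "length cs"])
qed

text \<open>The finite spanning set bounds the size of independent subsets, so a basis of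
  \<open>V\<close> is finite and can be listed.\<close>

lemma basis_list_exists:
  assumes "galg.subspace V" "V \<subseteq> galg.span F" "finite F"
  obtains bs where "basis_list bs V"
proof -
  obtain B where B: "B \<subseteq> V" "galg.independent B" "V \<subseteq> galg.span B"
    using galg.basis_exists[of V] by metis
  have "finite B" using galg.independent_span_bound[OF assms(3) B(2)] B(1) assms(2) by blast
  then obtain bs where "set bs = B" "distinct bs" using finite_distinct_list by blast
  moreover have "galg.span B = V" using B assms(1) by (simp add: galg.span_subspace)
  ultimately show thesis using that[of bs] B by (simp add: basis_list_def)
qed

lemma basis_list_dim: "basis_list bs V \<Longrightarrow> galg.dim V = length bs"
  by (metis basis_list_def galg.dim_eq_card_independent galg.dim_span distinct_card)

text \<open>An injective map keeps the basis independent, and an independent set in \<open>W\<close>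
  is no larger than a spanning set.\<close>

lemma basis_list_length_le:
  assumes bs: "basis_list bs V" and cs: "basis_list cs W"
    and f: "Vector_Spaces.linear fscale fscale f" and inj: "inj_on f V"
    and fW: "\<And>v. v \<in> V \<Longrightarrow> f v \<in> W"
  shows "length bs \<le> length cs"
proof -
  interpret f: Vector_Spaces.linear fscale fscale f by (rule f)
  have sub: "set bs \<subseteq> V" using bs by (auto simp: basis_list_def galg.span_base)
  have "galg.independent (f ` set bs)"
    using bs inj f.independent_injective_image[of "set bs"] by (simp add: basis_list_def)
  moreover have "f ` set bs \<subseteq> galg.span (set cs)" using sub fW cs by (auto simp: basis_list_def)
  ultimately have "card (f ` set bs) \<le> card (set cs)"
    using galg.independent_span_bound[of "set cs"] by blast
  moreover have "card (f ` set bs) = card (set bs)"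
    using inj sub by (intro card_image) (rule inj_on_subset)
  ultimately show ?thesis using bs cs by (simp add: basis_list_def distinct_card)
qed

text \<open>Spanning follows from the equal lengths: a vector of \<open>W\<close> outside the span
  of the image could be adjoined to it, giving an independent set larger than
  \<open>cs\<close>.\<close>

lemma basis_list_map:
  assumes bs: "basis_list bs V" and cs: "basis_list cs W" and len: "length bs = length cs"
    and f: "Vector_Spaces.linear fscale fscale f" and inj: "inj_on f V"
    and fW: "\<And>v. v \<in> V \<Longrightarrow> f v \<in> W"
  shows "basis_list (map f bs) W"
proof -
  interpret f: Vector_Spaces.linear fscale fscale f by (rule f)
  have sub: "set bs \<subseteq> V" using bs by (auto simp: basis_list_def galg.span_base)
  have dist: "distinct (map f bs)"
    using bs inj sub by (auto simp: basis_list_def distinct_map intro: inj_on_subset)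
  have ind: "galg.independent (f ` set bs)"
    using bs inj f.independent_injective_image[of "set bs"] by (simp add: basis_list_def)
  have fsub: "f ` set bs \<subseteq> W" using sub fW by auto
  have Wsub: "galg.subspace W" using cs by (auto simp: basis_list_def)
  have "W \<subseteq> galg.span (f ` set bs)"
  proof
    fix w assume w: "w \<in> W"
    show "w \<in> galg.span (f ` set bs)"
    proof (rule ccontr)
      assume nw: "w \<notin> galg.span (f ` set bs)"
      then have "galg.independent (insert w (f ` set bs))"
        using ind by (simp add: galg.independent_insertI)
      moreover have "insert w (f ` set bs) \<subseteq> galg.span (set cs)"
        using w fsub cs by (auto simp: basis_list_def)
      ultimately have "card (insert w (f ` set bs)) \<le> card (set cs)"
        using galg.independent_span_bound[of "set cs"] by blast
      moreover have "w \<notin> f ` set bs" using nw galg.span_base by blast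
      moreover have "card (f ` set bs) = length bs"
        using distinct_card[OF dist] by simp
      ultimately show False
        using len cs by (simp add: basis_list_def distinct_card)
    qed
  qed
  then have "galg.span (f ` set bs) = W" using fsub Wsub by (simp add: galg.span_subspace)
  then show ?thesis using dist ind by (simp add: basis_list_def)
qed

text \<open>Here \<open>f\<close> intertwines \<open>T\<close> and \<open>S\<close> up to the scalar
  \<open>c\<close>. In the application \<open>f\<close> maps a Specht module to that of the
  conjugate shape and \<open>c\<close> is the sign of a permutation.\<close>

lemma mat_of_map:
  assumes bs: "basis_list bs V" and cs: "basis_list (map f bs) W"
    and f: "Vector_Spaces.linear fscale fscale f" and fW: "\<And>v. v \<in> V \<Longrightarrow> f v \<in> W"
    and TV: "\<And>v. v \<in> V \<Longrightarrow> T v \<in> V"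
    and ST: "\<And>v. v \<in> V \<Longrightarrow> S (f v) = fscale c (f (T v))"
  shows "mat_of (map f bs) (map f bs) S = c \<cdot>\<^sub>m mat_of bs bs T"
proof (rule eq_matI)
  fix i j assume "i < dim_row (c \<cdot>\<^sub>m mat_of bs bs T)" "j < dim_col (c \<cdot>\<^sub>m mat_of bs bs T)"
  then have i: "i < length bs" and j: "j < length bs" by (auto simp: mat_of_def)
  interpret f: Vector_Spaces.linear fscale fscale f by (rule f)
  have bV: "bs ! k \<in> V" if "k < length bs" for k
    using bs that galg.span_base[of "bs ! k" "set bs"] by (auto simp: basis_list_def)
  let ?r = "\<lambda>k. galg.representation (set bs) (T (bs ! j)) (bs ! k)"
  have "f (T (bs ! j)) = f (\<Sum>k<length bs. fscale (?r k) (bs ! k))"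
    using basis_list_expand[OF bs TV[OF bV[OF j]]] by simp
  also have "\<dots> = (\<Sum>k<length bs. fscale (?r k) (f (bs ! k)))"
    by (simp add: f.sum f.scale)
  finally have "S (f (bs ! j)) = (\<Sum>k<length bs. fscale (c * ?r k) (map f bs ! k))"
    using ST[OF bV[OF j]] by (simp add: galg.scale_sum_right)
  moreover have "map f bs ! k \<in> galg.span (set (map f bs))" if "k < length bs" for k
    using that by (intro galg.span_base) auto
  ultimately have "galg.representation (set (map f bs)) (S (f (bs ! j))) (map f bs ! i) =
      (\<Sum>k<length bs. c * ?r k * galg.representation (set (map f bs)) (map f bs ! k) (map f bs ! i))"
    using cs representation_combination[of "set (map f bs)" "{..<length bs}" "(!) (map f bs)"
        "\<lambda>k. c * ?r k" "map f bs ! i"]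
    unfolding basis_list_def by (metis (no_types, lifting) lessThan_iff)
  also have "\<dots> = (\<Sum>k<length bs. if k = i then c * ?r i else 0)"
  proof (intro sum.cong refl)
    fix k assume "k \<in> {..<length bs}"
    moreover have "distinct (map f bs)" "galg.independent (set (map f bs))" using cs by (auto simp: basis_list_def)
    ultimately show "c * ?r k * galg.representation (set (map f bs)) (map f bs ! k) (map f bs ! i) =
        (if k = i then c * ?r i else 0)"
      using i galg.representation_basis[of "set (map f bs)" "map f bs ! k"]
        nth_eq_iff_index_eq[of "map f bs" k i] nth_mem[of k "map f bs"]
      by (auto simp del: nth_map set_map)
  qed
  finally show "mat_of (map f bs) (map f bs) S $$ (i, j) = (c \<cdot>\<^sub>m mat_of bs bs T) $$ (i, j)"
    using i j by (simp add: mat_of_def)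
qed (auto simp: mat_of_def)

subsection \<open>Group algebras and Specht modules\<close>

lemma linear_fscaleI:
  assumes "\<And>x y. T (x + y) = T x + T y" "\<And>c x. T (fscale c x) = fscale c (T x)"
  shows "Vector_Spaces.linear fscale fscale T"
  by (intro Vector_Spaces.linear.intro module_hom.intro module_hom_axioms.intro)
     (use assms in \<open>auto simp: galg.vector_space_axioms galg.module_axioms\<close>)

lemma linear_compose_fscale:
  assumes "Vector_Spaces.linear fscale fscale S" "Vector_Spaces.linear fscale fscale T"
  shows "Vector_Spaces.linear fscale fscale (\<lambda>x. S (T x))"
  using Vector_Spaces.linear_compose[OF assms(2,1)] by (simp add: o_def)

lemma linear_conv_right: "Vector_Spaces.linear fscale fscale (conv G x)"
  by (intro linear_fscaleI)
     (auto simp: conv_def fscale_def fun_eq_iff algebra_simps sum.distrib sum_distrib_left)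

lemma linear_conv_left: "Vector_Spaces.linear fscale fscale (\<lambda>x. conv G x y)"
  by (intro linear_fscaleI)
     (auto simp: conv_def fscale_def fun_eq_iff algebra_simps sum.distrib sum_distrib_left)

lemma conv_in_group_algebra [simp]: "conv G x y \<in> group_algebra G"
  by (simp add: conv_def group_algebra_def)

lemma subspace_group_algebra: "galg.subspace (group_algebra G)"
  by (auto simp: galg.subspace_def group_algebra_def fscale_def)

lemma sum_fun_apply: "(\<Sum>i\<in>I. f i) x = (\<Sum>i\<in>I. (f i x :: 'a::comm_monoid_add))"
  by (induction I rule: infinite_finite_induct) auto

lemma group_algebra_span:
  assumes "finite (carrier G)"
  shows "group_algebra G \<subseteq> galg.span ((\<lambda>g. indicator {g}) ` carrier G)"
proof
  fix x assume x: "x \<in> group_algebra G"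
  have "x = (\<Sum>g\<in>carrier G. fscale (x g) (indicator {g}))"
  proof
    fix h
    have "(\<Sum>g\<in>carrier G. fscale (x g) (indicator {g})) h = (\<Sum>g\<in>carrier G. x g * indicator {g} h)"
      by (simp add: sum_fun_apply fscale_def)
    also have "\<dots> = (\<Sum>g\<in>carrier G. if g = h then x h else 0)"
      by (intro sum.cong) (auto simp: indicator_def)
    also have "\<dots> = x h" using x assms by (auto simp: group_algebra_def)
    finally show "x h = (\<Sum>g\<in>carrier G. fscale (x g) (indicator {g})) h" ..
  qed
  also have "\<dots> \<in> galg.span ((\<lambda>g. indicator {g}) ` carrier G)"
    by (intro galg.span_sum galg.span_scale galg.span_base) auto
  finally show "x \<in> galg.span ((\<lambda>g. indicator {g}) ` carrier G)" .
qed

context group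
begin

lemma bij_betw_mult_left: "g \<in> carrier G \<Longrightarrow> bij_betw (\<lambda>h. g \<otimes> h) (carrier G) (carrier G)"
  by (rule bij_betwI[where g = "\<lambda>h. inv g \<otimes> h"]) (auto simp flip: m_assoc)

lemma conv_assoc:
  assumes fin: "finite (carrier G)"
  shows "conv G (conv G x y) z = conv G x (conv G y z)"
proof
  fix g
  show "conv G (conv G x y) z g = conv G x (conv G y z) g"
  proof (cases "g \<in> carrier G")
    case g: True
    have "conv G (conv G x y) z g =
        (\<Sum>h\<in>carrier G. \<Sum>k\<in>carrier G. x k * y (inv k \<otimes> h) * z (inv h \<otimes> g))"
      using g by (simp add: conv_def sum_distrib_right)
    also have "\<dots> = (\<Sum>k\<in>carrier G. \<Sum>h\<in>carrier G. x k * y (inv k \<otimes> h) * z (inv h \<otimes> g))"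
      by (rule sum.swap)
    \<comment> \<open>Substituting \<open>k \<otimes> h\<close> for \<open>h\<close> in the inner
      sum separates the three factors.\<close>
    also have "\<dots> = (\<Sum>k\<in>carrier G. \<Sum>h\<in>carrier G. x k * y h * z (inv h \<otimes> (inv k \<otimes> g)))"
    proof (rule sum.cong[OF refl])
      fix k assume k: "k \<in> carrier G"
      have "(\<Sum>h\<in>carrier G. x k * y (inv k \<otimes> h) * z (inv h \<otimes> g)) =
          (\<Sum>h\<in>carrier G. x k * y (inv k \<otimes> (k \<otimes> h)) * z (inv (k \<otimes> h) \<otimes> g))"
        by (rule sum.reindex_bij_betw[OF bij_betw_mult_left[OF k], symmetric])
      also have "\<dots> = (\<Sum>h\<in>carrier G. x k * y h * z (inv h \<otimes> (inv k \<otimes> g)))"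
        using k g by (intro sum.cong refl) (simp add: inv_mult_group m_assoc flip: m_assoc[of "inv k" k])
      finally show "(\<Sum>h\<in>carrier G. x k * y (inv k \<otimes> h) * z (inv h \<otimes> g)) =
        (\<Sum>h\<in>carrier G. x k * y h * z (inv h \<otimes> (inv k \<otimes> g)))" .
    qed
    also have "\<dots> = conv G x (conv G y z) g"
      using g by (simp add: conv_def sum_distrib_left mult.assoc)
    finally show ?thesis .
  qed (simp add: conv_def)
qed

lemma conv_indicator_left:
  assumes "finite (carrier G)" "s \<in> carrier G"
  shows "conv G (indicator {s}) x = (\<lambda>g. if g \<in> carrier G then x (inv s \<otimes> g) else 0)"
proof
  fix g
  have "(\<Sum>h\<in>carrier G. indicator {s} h * x (inv h \<otimes> g)) = (\<Sum>h\<in>carrier G. if h = s then x (inv s \<otimes> g) else 0)"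
    by (intro sum.cong) (auto simp: indicator_def)
  then show "conv G (indicator {s}) x g = (if g \<in> carrier G then x (inv s \<otimes> g) else 0)"
    using assms by (simp add: conv_def)
qed

lemma conv_indicator_right:
  assumes "finite (carrier G)" "s \<in> carrier G"
  shows "conv G x (indicator {s}) = (\<lambda>g. if g \<in> carrier G then x (g \<otimes> inv s) else 0)"
proof
  fix g
  show "conv G x (indicator {s}) g = (if g \<in> carrier G then x (g \<otimes> inv s) else 0)"
  proof (cases "g \<in> carrier G")
    case g: True
    have "(\<Sum>h\<in>carrier G. x h * indicator {s} (inv h \<otimes> g)) =
        (\<Sum>h\<in>carrier G. if h = g \<otimes> inv s then x (g \<otimes> inv s) else 0)"
    proof (intro sum.cong refl)
      fix h assume h: "h \<in> carrier G"
      have "inv h \<otimes> g = s \<longleftrightarrow> h = g \<otimes> inv s"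
        using g h assms(2) by (metis inv_closed inv_inv inv_solve_left inv_solve_right)
      then show "x h * indicator {s} (inv h \<otimes> g) = (if h = g \<otimes> inv s then x (g \<otimes> inv s) else 0)"
        by (auto simp: indicator_def)
    qed
    then show ?thesis using assms g by (simp add: conv_def)
  qed (simp add: conv_def)
qed

lemma conv_indicator_mult:
  assumes "finite (carrier G)" "s \<in> carrier G" "t \<in> carrier G"
  shows "conv G (indicator {s}) (indicator {t}) = indicator {s \<otimes> t}"
proof
  fix g
  have "inv s \<otimes> g = t \<longleftrightarrow> g = s \<otimes> t" if "g \<in> carrier G"
    using assms that by (metis inv_closed inv_inv inv_solve_left)
  then show "conv G (indicator {s}) (indicator {t}) g = indicator {s \<otimes> t} g"
    using assms by (auto simp: conv_indicator_left indicator_def)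
qed

lemma conv_one_left:
  assumes "finite (carrier G)" "x \<in> group_algebra G"
  shows "conv G (indicator {\<one>}) x = x"
  using assms by (auto simp: conv_indicator_left group_algebra_def)

lemma conv_one_right:
  assumes "finite (carrier G)" "x \<in> group_algebra G"
  shows "conv G x (indicator {\<one>}) = x"
  using assms by (auto simp: conv_indicator_right group_algebra_def)

end

section \<open>The Hermitian inner product in which the group elements are orthonormal\<close>

definition galg_inner :: "('g, 'b) monoid_scheme \<Rightarrow> ('g \<Rightarrow> complex) \<Rightarrow> ('g \<Rightarrow> complex) \<Rightarrow> complex"
  where "galg_inner G x y = (\<Sum>g\<in>carrier G. x g * cnj (y g))"

text \<open>The assumption on \<open>a\<close> says that it is fixed by the involution of the group
  algebra that inverts group elements and conjugates coefficients; right multiplication by such an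
  element is self-adjoint.\<close>

lemma (in group) galg_inner_conv:
  assumes "finite (carrier G)" and sa: "\<And>u. u \<in> carrier G \<Longrightarrow> a (inv u) = cnj (a u)"
  shows "galg_inner G (conv G x a) y = galg_inner G x (conv G y a)"
proof -
  have "galg_inner G (conv G x a) y =
      (\<Sum>g\<in>carrier G. \<Sum>h\<in>carrier G. x h * a (inv h \<otimes> g) * cnj (y g))"
    by (simp add: galg_inner_def conv_def sum_distrib_right)
  also have "\<dots> = (\<Sum>h\<in>carrier G. \<Sum>g\<in>carrier G. x h * a (inv h \<otimes> g) * cnj (y g))"
    by (rule sum.swap)
  also have "\<dots> = (\<Sum>h\<in>carrier G. \<Sum>g\<in>carrier G. x h * cnj (y g * a (inv g \<otimes> h)))"
  proof (intro sum.cong refl)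
    fix g h assume gh: "g \<in> carrier G" "h \<in> carrier G"
    have "a (inv h \<otimes> g) = a (inv (inv g \<otimes> h))" using gh by (simp add: inv_mult_group)
    also have "\<dots> = cnj (a (inv g \<otimes> h))" using gh by (intro sa) auto
    finally show "x h * a (inv h \<otimes> g) * cnj (y g) = x h * cnj (y g * a (inv g \<otimes> h))" by simp
  qed
  also have "\<dots> = galg_inner G x (conv G y a)"
    by (simp add: galg_inner_def conv_def sum_distrib_left)
  finally show ?thesis .
qed

lemma galg_inner_self_eq_0:
  assumes "finite (carrier G)" "x \<in> group_algebra G" "galg_inner G x x = 0"
  shows "x = 0"
proof -
  have "complex_of_real (\<Sum>g\<in>carrier G. (cmod (x g))\<^sup>2) = galg_inner G x x"
    by (simp add: galg_inner_def flip: complex_norm_square)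
  then have "(\<Sum>g\<in>carrier G. (cmod (x g))\<^sup>2) = 0"
    using assms(3) by (simp only: of_real_eq_0_iff)
  then have "\<forall>g\<in>carrier G. x g = 0"
    using assms(1) by (simp add: sum_nonneg_eq_0_iff)
  then show ?thesis using assms(2) by (auto simp: group_algebra_def fun_eq_iff)
qed

text \<open>
  Right multiplication by \<open>b a\<close> is the adjoint of right multiplication by \<open>a b\<close>, hence
  injective on the image of the latter.
\<close>

lemma (in group) conv_adjoint_eq_0:
  assumes fin: "finite (carrier G)"
    and a: "\<And>u. u \<in> carrier G \<Longrightarrow> a (inv u) = cnj (a u)"
    and b: "\<And>u. u \<in> carrier G \<Longrightarrow> b (inv u) = cnj (b u)"
    and v: "v = conv G x (conv G a b)" and 0: "conv G v (conv G b a) = 0"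
  shows "v = 0"
proof (rule galg_inner_self_eq_0[OF fin])
  show "v \<in> group_algebra G" by (simp add: v)
  \<comment> \<open>Writing one \<open>v\<close> as \<open>x a b\<close>, self-adjointness moves
    \<open>b\<close> and then \<open>a\<close> over to the other \<open>v\<close>.\<close>
  have "galg_inner G v v = galg_inner G (conv G (conv G v b) a) x"
    using fin by (simp add: v galg_inner_conv[where a = a, OF fin a] galg_inner_conv[where a = b, OF fin b] flip: conv_assoc)
  also have "\<dots> = 0"
    using 0 fin by (simp add: conv_assoc galg_inner_def)
  finally show "galg_inner G v v = 0" .
qed

section \<open>Specht modules and the action of permutations on them\<close>

lemma sym_group_finite [simp]: "finite (carrier (sym_group n))"
  by (simp add: sym_group_def finite_permutations)

lemma young_symmetrizer_in: "young_symmetrizer \<mu> \<in> group_algebra (sym_group (sum_list \<mu>))"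
  by (simp add: young_symmetrizer_def)

lemma subspace_specht: "galg.subspace (specht_module \<mu>)"
proof -
  interpret l: Vector_Spaces.linear fscale fscale
    "\<lambda>x. conv (sym_group (sum_list \<mu>)) x (young_symmetrizer \<mu>)"
    by (rule linear_conv_left)
  show ?thesis unfolding specht_module_def
    by (rule l.subspace_image[OF subspace_group_algebra])
qed

text \<open>The module lies in the finite-dimensional group algebra, so the choice defining
  \<open>specht_basis\<close> has a witness.\<close>

lemma specht_basis: "basis_list (specht_basis \<mu>) (specht_module \<mu>)"
proof -
  have "specht_module \<mu> \<subseteq> group_algebra (sym_group (sum_list \<mu>))"
    by (auto simp: specht_module_def)
  then obtain bs where "basis_list bs (specht_module \<mu>)"
    using basis_list_exists[OF subspace_specht, of \<mu>] group_algebra_span[of "sym_group (sum_list \<mu>)"]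
    by (metis finite_imageI subset_trans sym_group_finite)
  then show ?thesis
    unfolding basis_list_def specht_basis_def by (rule someI)
qed

lemma irrep_dim_eq: "irrep_dim \<mu> = length (specht_basis \<mu>)"
  using basis_list_dim[OF specht_basis] by (simp add: irrep_dim_def)

lemma irrep_eq: "irrep \<mu> \<sigma> = mat_of (specht_basis \<mu>) (specht_basis \<mu>)
    (conv (sym_group (sum_list \<mu>)) (indicator {\<sigma>}))"
  by (simp add: irrep_def mat_of_def Let_def)

lemma irrep_char_eq: "irrep_char \<mu> \<sigma> = mat_trace (irrep \<mu> \<sigma>)"
  by (simp add: irrep_char_def mat_trace_def)

lemma irrep_carrier [simp]: "irrep \<mu> \<sigma> \<in> carrier_mat (irrep_dim \<mu>) (irrep_dim \<mu>)"
  by (simp add: irrep_eq irrep_dim_eq)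

lemma specht_module_left_ideal:
  assumes "v \<in> specht_module \<mu>"
  shows "conv (sym_group (sum_list \<mu>)) x v \<in> specht_module \<mu>"
proof -
  obtain y where "v = conv (sym_group (sum_list \<mu>)) y (young_symmetrizer \<mu>)"
    using assms by (auto simp: specht_module_def)
  then have "conv (sym_group (sum_list \<mu>)) x v =
      conv (sym_group (sum_list \<mu>)) (conv (sym_group (sum_list \<mu>)) x y) (young_symmetrizer \<mu>)"
    by (simp add: group.conv_assoc[OF sym_group_is_group])
  then show ?thesis unfolding specht_module_def by (metis conv_in_group_algebra imageI)
qed

lemma specht_basis_in: "b \<in> set (specht_basis \<mu>) \<Longrightarrow> b \<in> specht_module \<mu>"
  by (metis basis_list_def galg.span_base specht_basis)

lemma specht_module_sub: "v \<in> specht_module \<mu> \<Longrightarrow> v \<in> group_algebra (sym_group (sum_list \<mu>))"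
  by (auto simp: specht_module_def)

lemma irrep_mult:
  assumes "\<sigma> permutes {1..sum_list \<mu>}" "\<tau> permutes {1..sum_list \<mu>}"
  shows "irrep \<mu> (\<sigma> \<circ> \<tau>) = irrep \<mu> \<sigma> * irrep \<mu> \<tau>"
proof -
  let ?G = "sym_group (sum_list \<mu>)"
  interpret G: group ?G by (rule sym_group_is_group)
  have "conv ?G (indicator {\<sigma> \<circ> \<tau>}) = (\<lambda>x. conv ?G (indicator {\<sigma>}) (conv ?G (indicator {\<tau>}) x))"
    using G.conv_indicator_mult[of \<sigma> \<tau>] assms
    by (simp add: sym_group_carrier sym_group_mult flip: G.conv_assoc)
  then show ?thesis
    unfolding irrep_eq
    by (simp add: mat_of_comp[OF specht_basis specht_basis linear_conv_right]
      specht_module_left_ideal specht_basis_in)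
qed

lemma irrep_id: "irrep \<mu> id = 1\<^sub>m (irrep_dim \<mu>)"
  unfolding irrep_eq irrep_dim_eq
proof (rule mat_of_id[OF specht_basis])
  interpret G: group "sym_group (sum_list \<mu>)" by (rule sym_group_is_group)
  fix b assume "b \<in> set (specht_basis \<mu>)"
  then show "conv (sym_group (sum_list \<mu>)) (indicator {id}) b = b"
    using G.conv_one_left[OF sym_group_finite] specht_module_sub specht_basis_in
    by (simp add: sym_group_one)
qed

lemma det_irrep_mult:
  assumes "\<sigma> permutes {1..sum_list \<mu>}" "\<tau> permutes {1..sum_list \<mu>}"
  shows "det (irrep \<mu> (\<sigma> \<circ> \<tau>)) = det (irrep \<mu> \<sigma>) * det (irrep \<mu> \<tau>)"
  using irrep_mult[OF assms] det_mult[OF irrep_carrier irrep_carrier, of \<mu> \<sigma> \<tau>] by simp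

lemma transpose_conjugate_12:
  fixes a b n :: nat
  assumes "a \<in> {1..n}" "b \<in> {1..n}" "a \<noteq> b"
  obtains p where "p permutes {1..n}" "transpose a b = p \<circ> transpose 1 2 \<circ> inv' p"
proof -
  have n: "2 \<le> n" using assms by (auto simp: Suc_le_eq numeral_2_eq_2)
  \<comment> \<open>\<open>c\<close> is the preimage of \<open>b\<close> under the swap
    \<open>q\<close> of 1 and \<open>a\<close>. Hence \<open>p\<close> sends 2 through
    \<open>c\<close> to \<open>b\<close>, and it sends 1 to \<open>a\<close> because
    \<open>c\<close> is not 1.\<close>
  define c where "c = transpose 1 a b"
  define q where "q = transpose 1 a"
  define p where "p = q \<circ> transpose 2 c"
  have c: "c \<in> {1..n}" "c \<noteq> 1" using assms n by (auto simp: c_def transpose_def)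
  have p: "p permutes {1..n}"
    unfolding p_def q_def using assms n c by (intro permutes_compose permutes_swap_id) auto
  have p12: "p 1 = a" "p 2 = b"
    using c by (auto simp: p_def q_def c_def transpose_def split: if_splits)
  have "p \<circ> transpose 1 2 = transpose a b \<circ> p"
  proof
    fix x
    show "(p \<circ> transpose 1 2) x = (transpose a b \<circ> p) x"
      using p12 permutes_inj[OF p] by (auto simp: transpose_def inj_eq simp flip: p12)
  qed
  then have "p \<circ> transpose 1 2 \<circ> inv' p = transpose a b \<circ> (p \<circ> inv' p)"
    by (simp add: comp_assoc)
  then show thesis using that[OF p] permutes_inv_o(1)[OF p] by simp
qed

text \<open>From size 2 on, \<open>k\<close> is the multiplicity of the eigenvalue -1 of
  \<open>irrep \<mu> (transpose 1 2)\<close>, so this operator has determinant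
  \<open>(-1) ^ k\<close>. Below size 2 the group is trivial and \<open>k = 0\<close> agrees with
  the default in \<open>irrep_g\<close>.\<close>

lemma irrep_g_nat:
  obtains k :: nat where "k \<le> irrep_dim \<mu>" "irrep_g \<mu> = of_nat k" "chiral \<mu> \<longleftrightarrow> odd k"
proof (cases "sum_list \<mu> \<ge> 2")
  case False
  have "\<sigma> = id" if "\<sigma> permutes {1..sum_list \<mu>}" for \<sigma>
  proof -
    have "sum_list \<mu> = 0 \<or> sum_list \<mu> = 1" using False by linarith
    then show ?thesis using that by auto
  qed
  then have "\<not> chiral \<mu>"
    unfolding chiral_def sym_group_carrier by (metis det_one irrep_id mem_Collect_eq sym_group_carrier)
  then show thesis using that[of 0] False by (simp add: irrep_g_def)
next
  case True
  let ?s = "transpose 1 2 :: nat \<Rightarrow> nat"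
  have s: "?s permutes {1..sum_list \<mu>}" using True by (intro permutes_swap_id) auto
  have "irrep \<mu> ?s * irrep \<mu> ?s = 1\<^sub>m (irrep_dim \<mu>)"
    using irrep_mult[OF s s] irrep_id by simp
  then obtain k where k: "k \<le> irrep_dim \<mu>" "mat_trace (irrep \<mu> ?s) = of_nat (irrep_dim \<mu>) - 2 * of_nat k"
    "det (irrep \<mu> ?s) = (-1) ^ k"
    using involution_mat_trace_det[OF irrep_carrier] by metis
  \<comment> \<open>All transpositions are conjugate, and the determinants of \<open>p\<close> and
    of its inverse cancel.\<close>
  have conj: "det (irrep \<mu> (transpose a b)) = det (irrep \<mu> ?s)"
    if "a \<in> {1..sum_list \<mu>}" "b \<in> {1..sum_list \<mu>}" "a \<noteq> b" for a b
  proof -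
    obtain p where p: "p permutes {1..sum_list \<mu>}" "transpose a b = p \<circ> ?s \<circ> inv' p"
      using transpose_conjugate_12 \<open>a \<in> _\<close> \<open>b \<in> _\<close> \<open>a \<noteq> b\<close> by blast
    have p': "inv' p permutes {1..sum_list \<mu>}" using p(1) by (rule permutes_inv)
    have "det (irrep \<mu> p) * det (irrep \<mu> (inv' p)) = 1"
      using det_irrep_mult[OF p(1) p'] permutes_inv_o(1)[OF p(1)] by (simp add: irrep_id)
    then show ?thesis
      using det_irrep_mult[OF permutes_compose[OF s p(1)] p'] det_irrep_mult[OF p(1) s] p(2)
      by simp
  qed
  \<comment> \<open>For even \<open>k\<close> every transposition has determinant 1; building a
    permutation from transpositions extends this to the whole group.\<close>
  have one: "det (irrep \<mu> \<sigma>) = 1" if "even k" "\<sigma> permutes {1..sum_list \<mu>}" for \<sigma>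
    using \<open>\<sigma> permutes _\<close> finite_atLeastAtMost[of 1 "sum_list \<mu>"]
  proof (induction rule: permutes_induct)
    case (swap a b p)
    then show ?case using \<open>even k\<close> conj[of a b] k(3)
      by (subst det_irrep_mult) (auto intro!: permutes_swap_id)
  qed (simp add: irrep_id[unfolded id_def])
  have "chiral \<mu> \<longleftrightarrow> odd k"
  proof (cases "even k")
    case True
    then show ?thesis using one by (simp add: chiral_def sym_group_carrier)
  next
    case False
    then have "det (irrep \<mu> ?s) \<noteq> 1" using k(3) by simp
    then show ?thesis using s False unfolding chiral_def sym_group_carrier[symmetric] by blast
  qed
  moreover have "irrep_g \<mu> = of_nat k"
    using True k(2) by (simp add: irrep_g_def irrep_char_eq)
  ultimately show thesis using that k(1) by blast
qed

subsection \<open>Conjugate partitions and tableaux\<close>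

text \<open>The Young diagram, with rows and columns both counted from 0, whereas
  \<open>tab_col\<close> counts from 1.\<close>

definition cells :: "nat list \<Rightarrow> (nat \<times> nat) set"
  where "cells \<mu> = (SIGMA i:{..<length \<mu>}. {..<\<mu> ! i})"

text \<open>The list of column lengths. Taking the number of columns from row 0 of the diagram
  covers the empty partition as well, where this row is empty.\<close>

definition conj_partition :: "nat list \<Rightarrow> nat list"
  where "conj_partition \<mu> = map (\<lambda>j. card {i. (i, j) \<in> cells \<mu>}) [0..<card {j. (0, j) \<in> cells \<mu>}]"

lemma cells_iff: "(i, j) \<in> cells \<mu> \<longleftrightarrow> i < length \<mu> \<and> j < \<mu> ! i"
  by (simp add: cells_def)

lemma card_cells: "card (cells \<mu>) = sum_list \<mu>"
  by (simp add: cells_def sum_list_sum_nth atLeast0LessThan)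

lemma finite_cells [simp]: "finite (cells \<mu>)"
  by (simp add: cells_def)

lemma finite_cells_row [simp]: "finite {j. (i, j) \<in> cells \<mu>}"
  and finite_cells_col [simp]: "finite {i. (i, j) \<in> cells \<mu>}"
  by (auto simp: cells_iff)

lemma card_cells_row: "i < length \<mu> \<Longrightarrow> card {j. (i, j) \<in> cells \<mu>} = \<mu> ! i"
  by (simp add: cells_iff)

text \<open>A finite downward closed set of naturals is an initial segment. This turns comparisons
  with row and column lengths into membership of cells.\<close>

lemma mem_downclosed_iff_less_card:
  fixes S :: "nat set"
  assumes "finite S" "\<And>x y. x \<in> S \<Longrightarrow> y < x \<Longrightarrow> y \<in> S"
  shows "x \<in> S \<longleftrightarrow> x < card S"
proof
  assume "x \<in> S"
  then have "{..x} \<subseteq> S" using assms(2) by (auto simp: le_less)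
  then show "x < card S" using card_mono[OF assms(1), of "{..x}"] by simp
next
  assume x: "x < card S"
  show "x \<in> S"
  proof (rule ccontr)
    assume "x \<notin> S"
    then have "S \<subseteq> {..<x}" using assms(2) by (metis lessThan_iff linorder_neqE_nat subsetI)
    then show False using x card_mono[of "{..<x}" S] by simp
  qed
qed

lemma cells_downclosed:
  assumes "sorted_wrt (\<ge>) \<mu>" "(i, j) \<in> cells \<mu>" "i' \<le> i" "j' \<le> j"
  shows "(i', j') \<in> cells \<mu>"
proof -
  have "\<mu> ! i \<le> \<mu> ! i'"
    using assms by (cases "i' = i") (auto simp: cells_iff sorted_wrt_iff_nth_less)
  then show ?thesis using assms by (auto simp: cells_iff)
qed

text \<open>Since the parts decrease weakly, row 0 and every column of the diagram are initial
  segments, so the two length conditions say that \<open>(0, j)\<close> and \<open>(i, j)\<close>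
  are cells; the second implies the first.\<close>

lemma cells_conj:
  assumes "sorted_wrt (\<ge>) \<mu>"
  shows "(j, i) \<in> cells (conj_partition \<mu>) \<longleftrightarrow> (i, j) \<in> cells \<mu>"
proof -
  have row: "j < card {j. (0, j) \<in> cells \<mu>} \<longleftrightarrow> (0, j) \<in> cells \<mu>"
    using mem_downclosed_iff_less_card[of "{j. (0, j) \<in> cells \<mu>}" j]
      cells_downclosed[OF assms, of 0 _ 0] by auto
  have col: "i < card {i. (i, j) \<in> cells \<mu>} \<longleftrightarrow> (i, j) \<in> cells \<mu>"
    using mem_downclosed_iff_less_card[of "{i. (i, j) \<in> cells \<mu>}" i]
      cells_downclosed[OF assms, of _ j _ j] by auto
  have "(j, i) \<in> cells (conj_partition \<mu>) \<longleftrightarrow>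
      j < card {j. (0, j) \<in> cells \<mu>} \<and> i < card {i. (i, j) \<in> cells \<mu>}"
    by (auto simp: cells_iff[of j i] conj_partition_def)
  also have "\<dots> \<longleftrightarrow> (i, j) \<in> cells \<mu>"
    unfolding row col using cells_downclosed[OF assms] by blast
  finally show ?thesis .
qed

lemma cells_conj_eq:
  assumes "sorted_wrt (\<ge>) \<mu>"
  shows "cells (conj_partition \<mu>) = prod.swap ` cells \<mu>"
proof (rule Set.set_eqI)
  fix x :: "nat \<times> nat"
  show "x \<in> cells (conj_partition \<mu>) \<longleftrightarrow> x \<in> prod.swap ` cells \<mu>"
    by (cases x) (force simp: cells_conj[OF assms])
qed

lemma conj_partition_in:
  assumes "\<mu> \<in> partitions_of n"
  shows "conj_partition \<mu> \<in> partitions_of n"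
proof -
  have s: "sorted_wrt (\<ge>) \<mu>" and n: "sum_list \<mu> = n" using assms by (auto simp: partitions_of_def)
  have "card {i. (i, j') \<in> cells \<mu>} \<le> card {i. (i, j) \<in> cells \<mu>}" if "j < j'" for j j'
    using cells_downclosed[OF s] that by (intro card_mono) auto
  then have sorted: "sorted_wrt (\<ge>) (conj_partition \<mu>)"
    by (simp add: conj_partition_def sorted_wrt_iff_nth_less)
  have pos: "p > 0" if p: "p \<in> set (conj_partition \<mu>)" for p
  proof -
    obtain j where "p = card {i. (i, j) \<in> cells \<mu>}" "j \<in> {0..<card {j. (0, j) \<in> cells \<mu>}}"
      using p unfolding conj_partition_def set_map set_upt by (rule imageE)
    then have j: "j < card {j. (0, j) \<in> cells \<mu>}" "p = card {i. (i, j) \<in> cells \<mu>}" by simp_all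
    have "j \<in> {j. (0, j) \<in> cells \<mu>}"
      using mem_downclosed_iff_less_card[of "{j. (0, j) \<in> cells \<mu>}" j] j(1)
        cells_downclosed[OF s, of 0 _ 0] by auto
    then show ?thesis using j(2) by (auto simp: card_gt_0_iff)
  qed
  have "card (cells (conj_partition \<mu>)) = card (cells \<mu>)"
    by (simp add: card_image cells_conj_eq[OF s])
  then have "sum_list (conj_partition \<mu>) = n" using n by (simp add: card_cells)
  then show ?thesis using sorted pos by (simp add: partitions_of_def)
qed

text \<open>Positivity of the parts lets column 0 determine the number of parts; the rows then
  determine the parts themselves.\<close>

lemma cells_inject:
  assumes "\<mu> \<in> partitions_of n" "\<nu> \<in> partitions_of m" "cells \<mu> = cells \<nu>"
  shows "\<mu> = \<nu>"
proof (rule nth_equalityI)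
  have *: "{i. (i, 0) \<in> cells \<xi>} = {..<length \<xi>}" if "\<xi> \<in> partitions_of k" for \<xi> k
    using that by (auto simp: cells_iff partitions_of_def)
  have "{..<length \<mu>} = {..<length \<nu>}"
    using *[OF assms(1)] *[OF assms(2)] assms(3) by simp
  then show "length \<mu> = length \<nu>" by simp
  fix i assume "i < length \<mu>"
  then show "\<mu> ! i = \<nu> ! i"
    using card_cells_row[of i \<mu>] card_cells_row[of i \<nu>] assms(3) \<open>length \<mu> = _\<close> by simp
qed

lemma conj_partition_conj:
  assumes "\<mu> \<in> partitions_of n"
  shows "conj_partition (conj_partition \<mu>) = \<mu>"
proof (rule cells_inject)
  show "conj_partition (conj_partition \<mu>) \<in> partitions_of n" "\<mu> \<in> partitions_of n"
    using assms by (simp_all add: conj_partition_in)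
  have "sorted_wrt (\<ge>) (conj_partition \<mu>)" "sorted_wrt (\<ge>) \<mu>"
    using conj_partition_in[OF assms] assms by (auto simp: partitions_of_def)
  then show "cells (conj_partition (conj_partition \<mu>)) = cells \<mu>"
    by (auto simp: cells_conj)
qed

section \<open>Entries of the consecutively filled tableau and their cells\<close>

lemma tab_row_col:
  assumes "k \<in> {1..sum_list \<mu>}"
  shows "tab_row \<mu> k < length \<mu>" "1 \<le> tab_col \<mu> k" "tab_col \<mu> k \<le> \<mu> ! tab_row \<mu> k"
    "k = sum_list (take (tab_row \<mu> k) \<mu>) + tab_col \<mu> k"
proof -
  let ?pre = "\<lambda>i. sum_list (take i \<mu>)" and ?r = "tab_row \<mu> k"
  have "k \<le> ?pre (Suc (length \<mu>))" using assms by simp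
  then have up: "k \<le> ?pre (Suc ?r)" unfolding tab_row_def by (rule LeastI)
  \<comment> \<open>By minimality of the row index, the rows before it do not reach
    \<open>k\<close>.\<close>
  have low: "?pre ?r < k"
  proof (cases ?r)
    case (Suc i)
    then have "\<not> k \<le> ?pre (Suc i)"
      unfolding tab_row_def by (metis lessI not_less_Least)
    then show ?thesis using Suc by simp
  qed (use assms in simp)
  show r: "?r < length \<mu>" using low assms by (metis atLeastAtMost_iff not_le take_all)
  show "1 \<le> tab_col \<mu> k" "k = ?pre ?r + tab_col \<mu> k"
    using low by (auto simp: tab_col_def)
  show "tab_col \<mu> k \<le> \<mu> ! ?r"
    using up r by (simp add: tab_col_def take_Suc_conv_app_nth)
qed

text \<open>An injection into a set of the same size is onto. The shift by 1 translates the column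
  count of \<open>tab_col\<close> into that of \<open>cells\<close>.\<close>

lemma bij_betw_tableau:
  "bij_betw (\<lambda>k. (tab_row \<mu> k, tab_col \<mu> k - 1)) {1..sum_list \<mu>} (cells \<mu>)"
proof -
  let ?c = "\<lambda>k. (tab_row \<mu> k, tab_col \<mu> k - 1)"
  have inj: "inj_on ?c {1..sum_list \<mu>}"
  proof (rule inj_onI)
    fix k l assume "k \<in> {1..sum_list \<mu>}" "l \<in> {1..sum_list \<mu>}" "?c k = ?c l"
    then show "k = l" using tab_row_col(2,4)[of k \<mu>] tab_row_col(2,4)[of l \<mu>] by auto
  qed
  have "?c k \<in> cells \<mu>" if "k \<in> {1..sum_list \<mu>}" for k
    using tab_row_col[OF that] by (auto simp: cells_iff)
  then have "?c ` {1..sum_list \<mu>} \<subseteq> cells \<mu>" by blast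
  moreover have "card (?c ` {1..sum_list \<mu>}) = card (cells \<mu>)"
    using inj by (simp add: card_image card_cells)
  ultimately show ?thesis using inj by (simp add: bij_betw_def card_subset_eq)
qed

text \<open>Transposing the tableau of \<open>\<mu>\<close> fills the conjugate shape, but in
  general not consecutively; \<open>\<pi>\<close> is the relabelling that corrects this.\<close>

lemma conj_tableau_permutation:
  assumes \<mu>: "\<mu> \<in> partitions_of n"
  obtains \<pi> where "\<pi> permutes {1..n}"
    "\<And>k l. k \<in> {1..n} \<Longrightarrow> l \<in> {1..n} \<Longrightarrow>
      tab_row (conj_partition \<mu>) (\<pi> k) = tab_row (conj_partition \<mu>) (\<pi> l) \<longleftrightarrow> tab_col \<mu> k = tab_col \<mu> l"
    "\<And>k l. k \<in> {1..n} \<Longrightarrow> l \<in> {1..n} \<Longrightarrow>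
      tab_col (conj_partition \<mu>) (\<pi> k) = tab_col (conj_partition \<mu>) (\<pi> l) \<longleftrightarrow> tab_row \<mu> k = tab_row \<mu> l"
proof -
  let ?\<mu>' = "conj_partition \<mu>"
  define c where "c \<nu> k = (tab_row \<nu> k, tab_col \<nu> k - 1)" for \<nu> k
  have n: "sum_list \<mu> = n" "sum_list ?\<mu>' = n" and s: "sorted_wrt (\<ge>) \<mu>"
    using \<mu> conj_partition_in[OF \<mu>] by (auto simp: partitions_of_def)
  have c: "bij_betw (c \<mu>) {1..n} (cells \<mu>)" "bij_betw (c ?\<mu>') {1..n} (cells ?\<mu>')"
    using bij_betw_tableau[of \<mu>] bij_betw_tableau[of ?\<mu>'] unfolding n c_def by auto
  have sw: "bij_betw prod.swap (cells \<mu>) (cells ?\<mu>')"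
    by (simp add: bij_betw_def cells_conj_eq[OF s])
  \<comment> \<open>An entry goes to its cell, is reflected, and is then read off in the consecutive
    tableau of the conjugate shape.\<close>
  define f where "f = inv_into {1..n} (c ?\<mu>') \<circ> (prod.swap \<circ> c \<mu>)"
  have f: "bij_betw f {1..n} {1..n}"
    unfolding f_def using c sw by (intro bij_betw_trans bij_betw_inv_into)
  define \<pi> where "\<pi> k = (if k \<in> {1..n} then f k else k)" for k
  have "bij_betw \<pi> {1..n} {1..n}" using f bij_betw_cong[of "{1..n}" f \<pi> "{1..n}"] by (simp add: \<pi>_def)
  then have \<pi>: "\<pi> permutes {1..n}" by (rule bij_imp_permutes) (auto simp: \<pi>_def)
  have "c ?\<mu>' (\<pi> k) = prod.swap (c \<mu> k)" if "k \<in> {1..n}" for k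
  proof -
    have "prod.swap (c \<mu> k) \<in> c ?\<mu>' ` {1..n}"
      using c sw that by (metis bij_betw_apply bij_betw_imp_surj_on)
    then show ?thesis using that by (simp add: \<pi>_def f_def f_inv_into_f)
  qed
  then have 1: "tab_row ?\<mu>' (\<pi> k) = tab_col \<mu> k - 1" "tab_col ?\<mu>' (\<pi> k) - 1 = tab_row \<mu> k"
    if "k \<in> {1..n}" for k using that by (auto simp: c_def)
  \<comment> \<open>These bounds allow the truncated subtraction of 1 to be cancelled.\<close>
  have 2: "tab_col \<mu> k \<ge> 1" "tab_col ?\<mu>' (\<pi> k) \<ge> 1" if "k \<in> {1..n}" for k
    using tab_row_col(2)[of k \<mu>] tab_row_col(2)[of "\<pi> k" ?\<mu>'] that permutes_in_image[OF \<pi>, of k]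
    unfolding n by auto
  show thesis
  proof (rule that[OF \<pi>])
    fix k l assume kl: "k \<in> {1..n}" "l \<in> {1..n}"
    show "tab_row ?\<mu>' (\<pi> k) = tab_row ?\<mu>' (\<pi> l) \<longleftrightarrow> tab_col \<mu> k = tab_col \<mu> l"
      using 1(1)[OF kl(1)] 1(1)[OF kl(2)] 2(1)[OF kl(1)] 2(1)[OF kl(2)] by auto
    show "tab_col ?\<mu>' (\<pi> k) = tab_col ?\<mu>' (\<pi> l) \<longleftrightarrow> tab_row \<mu> k = tab_row \<mu> l"
      using 1(2)[OF kl(1)] 1(2)[OF kl(2)] 2(2)[OF kl(1)] 2(2)[OF kl(2)] by auto
  qed
qed

text \<open>Conjugation by \<open>\<pi>\<close> carries the stabiliser of the labelling
  \<open>t\<close> to that of \<open>t'\<close>; it is used with rows and columns as labels.\<close>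

lemma permutes_label_invariant_iff:
  assumes \<pi>: "\<pi> permutes S" and q: "q permutes S"
    and lab: "\<And>k l. k \<in> S \<Longrightarrow> l \<in> S \<Longrightarrow> t' (\<pi> k) = t' (\<pi> l) \<longleftrightarrow> t k = t l"
  shows "(\<forall>k\<in>S. t' ((\<pi> \<circ> q \<circ> inv' \<pi>) k) = t' k) \<longleftrightarrow> (\<forall>k\<in>S. t (q k) = t k)"
proof -
  have "(\<forall>k\<in>S. t' ((\<pi> \<circ> q \<circ> inv' \<pi>) k) = t' k) \<longleftrightarrow> (\<forall>k\<in>\<pi> ` S. t' ((\<pi> \<circ> q \<circ> inv' \<pi>) k) = t' k)"
    by (simp add: permutes_image[OF \<pi>])
  also have "\<dots> \<longleftrightarrow> (\<forall>k\<in>S. t' (\<pi> (q k)) = t' (\<pi> k))"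
    by (simp add: permutes_inverses(2)[OF \<pi>])
  also have "\<dots> \<longleftrightarrow> (\<forall>k\<in>S. t (q k) = t k)"
    using lab permutes_in_image[OF q] by auto
  finally show ?thesis .
qed

lemma permutes_label_invariant_inv:
  assumes p: "p permutes S"
  shows "(\<forall>k\<in>S. t (inv' p k) = t k) \<longleftrightarrow> (\<forall>k\<in>S. t (p k) = t k)"
proof -
  have "(\<forall>k\<in>S. t (inv' p k) = t k) \<longleftrightarrow> (\<forall>k\<in>p ` S. t (inv' p k) = t k)"
    by (simp add: permutes_image[OF p])
  then show ?thesis by (auto simp: permutes_inverses(2)[OF p])
qed

subsection \<open>Conjugation is tensoring with the sign\<close>

lemma conv_fscale_left: "conv G (fscale c x) y = fscale c (conv G x y)"
  by (simp add: conv_def fscale_def fun_eq_iff sum_distrib_left mult.assoc)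

text \<open>The automorphism of the group algebra that multiplies each permutation by its
  sign.\<close>

definition sign_twist :: "((nat \<Rightarrow> nat) \<Rightarrow> complex) \<Rightarrow> (nat \<Rightarrow> nat) \<Rightarrow> complex"
  where "sign_twist x = (\<lambda>g. of_int (sign g) * x g)"

lemma linear_sign_twist: "Vector_Spaces.linear fscale fscale sign_twist"
  by (intro linear_fscaleI) (auto simp: sign_twist_def fscale_def fun_eq_iff algebra_simps)

lemma sign_twist_in: "x \<in> group_algebra G \<Longrightarrow> sign_twist x \<in> group_algebra G"
  by (simp add: group_algebra_def sign_twist_def)

lemma sign_twist_eq_0: "sign_twist x = 0 \<Longrightarrow> x = 0"
  by (auto simp: sign_twist_def fun_eq_iff sign_def split: if_splits)

lemma sign_twist_indicator: "sign_twist (indicator {\<sigma>}) = fscale (of_int (sign \<sigma>)) (indicator {\<sigma>})"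
  by (rule ext) (simp add: sign_twist_def fscale_def indicator_def)

lemma sign_twist_conv:
  "sign_twist (conv (sym_group n) x y) = conv (sym_group n) (sign_twist x) (sign_twist y)"
proof
  fix g
  let ?G = "sym_group n"
  show "sign_twist (conv ?G x y) g = conv ?G (sign_twist x) (sign_twist y) g"
  proof (cases "g \<in> carrier ?G")
    case g: True
    have "of_int (sign g) * (x h * y (inv\<^bsub>?G\<^esub> h \<otimes>\<^bsub>?G\<^esub> g)) =
        sign_twist x h * sign_twist y (inv\<^bsub>?G\<^esub> h \<otimes>\<^bsub>?G\<^esub> g)" if h: "h \<in> carrier ?G" for h
    proof -
      have "permutation g" "permutation h" using g h by (auto intro: sym_group_carrier')
      \<comment> \<open>The sign of \<open>h\<close> occurs twice in the product of the twisted
        factors and cancels, leaving that of \<open>g\<close>.\<close>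
      then have "sign (inv\<^bsub>?G\<^esub> h \<otimes>\<^bsub>?G\<^esub> g) = sign h * sign g"
        using h by (simp add: sym_group_mult sign_compose sign_inverse permutation_inverse)
      then show ?thesis by (simp add: sign_twist_def sign_def)
    qed
    moreover have "sign_twist (conv ?G x y) g =
        (\<Sum>h\<in>carrier ?G. of_int (sign g) * (x h * y (inv\<^bsub>?G\<^esub> h \<otimes>\<^bsub>?G\<^esub> g)))"
      using g unfolding sign_twist_def by (simp add: conv_def sum_distrib_left)
    ultimately show ?thesis using g by (simp add: conv_def)
  qed (simp add: conv_def sign_twist_def)
qed

section \<open>Row symmetrizers, column antisymmetrizers and the map to the conjugate Specht
  module\<close>

abbreviation row_symmetrizer :: "nat list \<Rightarrow> (nat \<Rightarrow> nat) \<Rightarrow> complex"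
  where "row_symmetrizer \<mu> \<equiv> indicator (row_group \<mu>)"

definition col_antisymmetrizer :: "nat list \<Rightarrow> (nat \<Rightarrow> nat) \<Rightarrow> complex"
  where "col_antisymmetrizer \<mu> = (\<lambda>p. if p \<in> col_group \<mu> then of_int (sign p) else 0)"

lemma young_symmetrizer_eq:
  "young_symmetrizer \<mu> = conv (sym_group (sum_list \<mu>)) (row_symmetrizer \<mu>) (col_antisymmetrizer \<mu>)"
  by (simp add: young_symmetrizer_def col_antisymmetrizer_def)

lemma row_symmetrizer_self_adjoint:
  assumes "p \<in> carrier (sym_group (sum_list \<mu>))"
  shows "row_symmetrizer \<mu> (inv\<^bsub>sym_group (sum_list \<mu>)\<^esub> p) = cnj (row_symmetrizer \<mu> p)"
proof -
  have "inv' p \<in> row_group \<mu> \<longleftrightarrow> p \<in> row_group \<mu>"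
    using assms permutes_label_invariant_inv[of p "{1..sum_list \<mu>}" "tab_row \<mu>"] permutes_inv
    unfolding row_group_def sym_group_carrier by blast
  then show ?thesis using assms by (simp add: indicator_def)
qed

lemma col_antisymmetrizer_self_adjoint:
  assumes "p \<in> carrier (sym_group (sum_list \<mu>))"
  shows "col_antisymmetrizer \<mu> (inv\<^bsub>sym_group (sum_list \<mu>)\<^esub> p) = cnj (col_antisymmetrizer \<mu> p)"
proof -
  have "inv' p \<in> col_group \<mu> \<longleftrightarrow> p \<in> col_group \<mu>"
    using assms permutes_label_invariant_inv[of p "{1..sum_list \<mu>}" "tab_col \<mu>"] permutes_inv
    unfolding col_group_def sym_group_carrier by blast
  then show ?thesis
    using assms sym_group_carrier'[OF assms] by (simp add: col_antisymmetrizer_def sign_inverse)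
qed

text \<open>
  Up to a relabelling of the entries, passing to the conjugate shape and twisting by the sign
  both exchange the row symmetrizer and the column antisymmetrizer.
\<close>

lemma conj_symmetrizers:
  assumes "\<mu> \<in> partitions_of n"
  obtains \<pi> where "\<pi> \<in> carrier (sym_group n)"
    "conv (sym_group n) (indicator {\<pi>}) (sign_twist (col_antisymmetrizer \<mu>)) =
      conv (sym_group n) (row_symmetrizer (conj_partition \<mu>)) (indicator {\<pi>})"
    "conv (sym_group n) (indicator {\<pi>}) (sign_twist (row_symmetrizer \<mu>)) =
      conv (sym_group n) (col_antisymmetrizer (conj_partition \<mu>)) (indicator {\<pi>})"
proof -
  let ?G = "sym_group n" and ?\<mu>' = "conj_partition \<mu>"
  interpret G: group ?G by (rule sym_group_is_group)
  have n: "sum_list \<mu> = n" "sum_list ?\<mu>' = n"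
    using assms conj_partition_in[OF assms] by (auto simp: partitions_of_def)
  obtain \<pi> where \<pi>: "\<pi> permutes {1..n}"
    and row: "\<And>k l. k \<in> {1..n} \<Longrightarrow> l \<in> {1..n} \<Longrightarrow>
      tab_row ?\<mu>' (\<pi> k) = tab_row ?\<mu>' (\<pi> l) \<longleftrightarrow> tab_col \<mu> k = tab_col \<mu> l"
    and col: "\<And>k l. k \<in> {1..n} \<Longrightarrow> l \<in> {1..n} \<Longrightarrow>
      tab_col ?\<mu>' (\<pi> k) = tab_col ?\<mu>' (\<pi> l) \<longleftrightarrow> tab_row \<mu> k = tab_row \<mu> l"
    using conj_tableau_permutation[OF assms] by blast
  have \<pi>G: "\<pi> \<in> carrier ?G" using \<pi> by (simp add: sym_group_carrier)
  have conj_perm: "\<pi> \<circ> u \<circ> inv' \<pi> permutes {1..n}" if "u permutes {1..n}" for u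
    using that \<pi> by (intro permutes_compose permutes_inv)
  have R: "\<pi> \<circ> u \<circ> inv' \<pi> \<in> row_group ?\<mu>' \<longleftrightarrow> u \<in> col_group \<mu>" if "u permutes {1..n}" for u
    using permutes_label_invariant_iff[where t = "tab_col \<mu>" and t' = "tab_row ?\<mu>'", OF \<pi> that row] that conj_perm[OF that]
    unfolding row_group_def col_group_def sym_group_carrier n by blast
  have C: "\<pi> \<circ> u \<circ> inv' \<pi> \<in> col_group ?\<mu>' \<longleftrightarrow> u \<in> row_group \<mu>" if "u permutes {1..n}" for u
    using permutes_label_invariant_iff[where t = "tab_row \<mu>" and t' = "tab_col ?\<mu>'", OF \<pi> that col] that conj_perm[OF that]
    unfolding row_group_def col_group_def sym_group_carrier n by blast
  have sgn: "sign (\<pi> \<circ> u \<circ> inv' \<pi>) = sign u" if "u permutes {1..n}" for u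
  proof -
    have "permutation \<pi>" "permutation u" using that \<pi> by (auto simp: permutation_permutes)
    then show ?thesis
      by (simp add: sign_compose sign_inverse permutation_inverse permutation_compose sign_idempotent mult.commute[of _ "sign u"] mult.assoc)
  qed
  \<comment> \<open>Intertwining by \<open>\<pi>\<close> reduces to comparing coefficients at
    \<open>u\<close> and at its conjugate under \<open>\<pi>\<close>.\<close>
  have eqI: "conv ?G (indicator {\<pi>}) x = conv ?G y (indicator {\<pi>})"
    if "\<And>u. u permutes {1..n} \<Longrightarrow> x u = y (\<pi> \<circ> u \<circ> inv' \<pi>)" for x y :: "(nat \<Rightarrow> nat) \<Rightarrow> complex"
  proof
    fix g
    show "conv ?G (indicator {\<pi>}) x g = conv ?G y (indicator {\<pi>}) g"
    proof (cases "g permutes {1..n}")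
      case True
      then have "inv' \<pi> \<circ> g permutes {1..n}" using \<pi> by (intro permutes_compose permutes_inv)
      moreover have "\<pi> \<circ> (inv' \<pi> \<circ> g) = g"
        using permutes_inv_o(1)[OF \<pi>] by (simp flip: comp_assoc)
      ultimately show ?thesis using that[of "inv' \<pi> \<circ> g"] \<pi>G
        by (simp add: G.conv_indicator_left G.conv_indicator_right sym_group_mult)
    qed (simp add: conv_def sym_group_carrier)
  qed
  show thesis
  proof (rule that[OF \<pi>G]; rule eqI)
    fix u assume u: "u permutes {1..n}"
    show "sign_twist (col_antisymmetrizer \<mu>) u = row_symmetrizer ?\<mu>' (\<pi> \<circ> u \<circ> inv' \<pi>)"
      using R[OF u] by (simp add: sign_twist_def col_antisymmetrizer_def indicator_def sign_idempotent flip: of_int_mult)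
    show "sign_twist (row_symmetrizer \<mu>) u = col_antisymmetrizer ?\<mu>' (\<pi> \<circ> u \<circ> inv' \<pi>)"
      using C[OF u] sgn[OF u] by (simp add: sign_twist_def col_antisymmetrizer_def indicator_def)
  qed
qed

text \<open>With \<open>R\<close> and \<open>C\<close> the two symmetrizers of \<open>\<mu>\<close>,
  right multiplication by \<open>C R\<close> is injective on the ideal of \<open>R C\<close> by
  adjointness. The sign twist makes \<open>C R\<close> a conjugate of the Young symmetrizer of the
  conjugate shape, and a right translation by the inverse of \<open>\<pi>\<close> lands in its
  module. Right multiplications commute with the left action, so only the twist produces the
  sign.\<close>

lemma specht_conj_twist:
  assumes \<mu>: "\<mu> \<in> partitions_of n"
  obtains \<phi> where "Vector_Spaces.linear fscale fscale \<phi>" "inj_on \<phi> (specht_module \<mu>)"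
    "\<And>v. v \<in> specht_module \<mu> \<Longrightarrow> \<phi> v \<in> specht_module (conj_partition \<mu>)"
    "\<And>\<sigma> v. \<phi> (conv (sym_group n) (indicator {\<sigma>}) v) =
      fscale (of_int (sign \<sigma>)) (conv (sym_group n) (indicator {\<sigma>}) (\<phi> v))"
proof -
  let ?G = "sym_group n" and ?\<mu>' = "conj_partition \<mu>"
  let ?R = "row_symmetrizer \<mu>" and ?C = "col_antisymmetrizer \<mu>"
  interpret G: group ?G by (rule sym_group_is_group)
  note assoc = G.conv_assoc[OF sym_group_finite]
  have n: "sum_list \<mu> = n" "sum_list ?\<mu>' = n"
    using \<mu> conj_partition_in[OF \<mu>] by (auto simp: partitions_of_def)
  obtain \<pi> where \<pi>: "\<pi> \<in> carrier ?G"
    and R': "conv ?G (indicator {\<pi>}) (sign_twist ?C) = conv ?G (row_symmetrizer ?\<mu>') (indicator {\<pi>})"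
    and C': "conv ?G (indicator {\<pi>}) (sign_twist ?R) = conv ?G (col_antisymmetrizer ?\<mu>') (indicator {\<pi>})"
    using conj_symmetrizers[OF \<mu>] by blast
  define p q where "p = (indicator {\<pi>} :: _ \<Rightarrow> complex)" and "q = (indicator {inv\<^bsub>?G\<^esub> \<pi>} :: _ \<Rightarrow> complex)"
  have pq: "conv ?G p (conv ?G q x) = x" "conv ?G q (conv ?G p x) = x"
    "conv ?G (conv ?G x p) q = x" "conv ?G (conv ?G x q) p = x" if "x \<in> group_algebra ?G" for x
    using \<pi> that unfolding p_def q_def
    by (simp_all add: assoc G.conv_indicator_mult G.conv_one_right del: sym_group_inv_equality)
       (simp_all add: G.conv_indicator_mult G.conv_one_left del: sym_group_inv_equality flip: assoc)
  define \<phi> where "\<phi> v = conv ?G (sign_twist (conv ?G v (conv ?G ?C ?R))) q" for v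
  have lin: "Vector_Spaces.linear fscale fscale \<phi>"
    unfolding \<phi>_def
    by (rule linear_compose_fscale[OF linear_conv_left], rule linear_compose_fscale[OF linear_sign_twist], rule linear_conv_left)
  interpret \<phi>: Vector_Spaces.linear fscale fscale \<phi> by (rule lin)
  have equiv: "\<phi> (conv ?G (indicator {\<sigma>}) v) = fscale (of_int (sign \<sigma>)) (conv ?G (indicator {\<sigma>}) (\<phi> v))"
    for \<sigma> v
  proof -
    have "\<phi> (conv ?G (indicator {\<sigma>}) v) =
        conv ?G (fscale (of_int (sign \<sigma>)) (indicator {\<sigma>})) (\<phi> v)"
      by (simp add: \<phi>_def assoc sign_twist_conv sign_twist_indicator)
    then show ?thesis by (simp add: conv_fscale_left)
  qed
  have img: "\<phi> v \<in> specht_module ?\<mu>'" for v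
  proof -
    \<comment> \<open>Moving \<open>p\<close> rightwards past the twisted \<open>C\<close> and
      \<open>R\<close> shows that the twisted \<open>C R\<close> is \<open>q\<close> times the new
      Young symmetrizer times \<open>p\<close>; the final factor \<open>q\<close> of
      \<open>\<phi>\<close> cancels this \<open>p\<close>.\<close>
    let ?CR = "conv ?G (sign_twist ?C) (sign_twist ?R)"
    have "?CR = conv ?G q (conv ?G p ?CR)" by (simp add: pq)
    also have "conv ?G p ?CR = conv ?G (conv ?G p (sign_twist ?C)) (sign_twist ?R)" by (simp add: assoc)
    also have "\<dots> = conv ?G (row_symmetrizer ?\<mu>') (conv ?G p (sign_twist ?R))"
      unfolding p_def R' by (simp add: assoc)
    also have "\<dots> = conv ?G (young_symmetrizer ?\<mu>') p"
      unfolding p_def C' by (simp add: assoc young_symmetrizer_eq n)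
    finally have "\<phi> v = conv ?G (sign_twist v) (conv ?G (conv ?G (conv ?G q (young_symmetrizer ?\<mu>')) p) q)"
      by (simp add: \<phi>_def sign_twist_conv assoc)
    moreover have "conv ?G (young_symmetrizer ?\<mu>') (conv ?G p q) = young_symmetrizer ?\<mu>'"
      using pq(3)[of "young_symmetrizer ?\<mu>'"] young_symmetrizer_in[of ?\<mu>'] by (simp add: assoc n)
    ultimately have "\<phi> v = conv ?G (conv ?G (sign_twist v) q) (young_symmetrizer ?\<mu>')"
      by (simp add: assoc)
    then show ?thesis unfolding specht_module_def n by (metis conv_in_group_algebra imageI)
  qed
  have "\<forall>v\<in>specht_module \<mu>. \<phi> v = 0 \<longrightarrow> v = 0"
  proof (intro ballI impI)
    fix v assume v: "v \<in> specht_module \<mu>" and 0: "\<phi> v = 0"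
    let ?w = "conv ?G v (conv ?G ?C ?R)"
    \<comment> \<open>Multiplying by \<open>p\<close> undoes \<open>q\<close>, and the twist is
      injective; hence \<open>v C R = 0\<close>, while \<open>v\<close> has the form
      \<open>x R C\<close>.\<close>
    have "sign_twist ?w = conv ?G (\<phi> v) p"
      unfolding \<phi>_def by (simp add: pq sign_twist_in)
    also have "\<dots> = 0" unfolding 0 by (simp add: conv_def fun_eq_iff)
    finally have "?w = 0" by (rule sign_twist_eq_0)
    moreover obtain x where "v = conv ?G x (conv ?G ?R ?C)"
      using v by (auto simp: specht_module_def young_symmetrizer_eq n)
    ultimately show "v = 0"
      using G.conv_adjoint_eq_0[OF sym_group_finite, of ?R ?C v x]
        row_symmetrizer_self_adjoint[of _ \<mu>] col_antisymmetrizer_self_adjoint[of _ \<mu>] n by auto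
  qed
  then have "inj_on \<phi> (specht_module \<mu>)"
    by (simp add: \<phi>.inj_on_iff_eq_0[OF subspace_specht])
  then show thesis using that[OF lin] img equiv by blast
qed

text \<open>The injection into the conjugate module gives one inequality; the same for the conjugate
  shape, whose conjugate is \<open>\<mu>\<close>, gives the other.\<close>

lemma irrep_dim_conj:
  assumes "\<mu> \<in> partitions_of n"
  shows "irrep_dim (conj_partition \<mu>) = irrep_dim \<mu>"
proof -
  have le: "irrep_dim \<nu> \<le> irrep_dim (conj_partition \<nu>)" if \<nu>: "\<nu> \<in> partitions_of n" for \<nu>
    using specht_conj_twist[OF \<nu>] basis_list_length_le[OF specht_basis specht_basis]
    unfolding irrep_dim_eq by metis
  show ?thesis
    using le[OF assms] le[OF conj_partition_in[OF assms]] conj_partition_conj[OF assms] by simp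
qed

text \<open>As the dimensions agree, \<open>\<phi>\<close> carries a basis to a basis, in which the
  matrix of \<open>\<sigma>\<close> is the old one times its sign.\<close>

lemma irrep_char_conj:
  assumes "\<mu> \<in> partitions_of n"
  shows "irrep_char (conj_partition \<mu>) \<sigma> = of_int (sign \<sigma>) * irrep_char \<mu> \<sigma>"
proof -
  let ?G = "sym_group n" and ?\<mu>' = "conj_partition \<mu>"
  let ?T = "conv ?G (indicator {\<sigma>})"
  have n: "sum_list \<mu> = n" "sum_list ?\<mu>' = n"
    using assms conj_partition_in[OF assms] by (auto simp: partitions_of_def)
  obtain \<phi> where \<phi>: "Vector_Spaces.linear fscale fscale \<phi>" "inj_on \<phi> (specht_module \<mu>)"
    "\<And>v. v \<in> specht_module \<mu> \<Longrightarrow> \<phi> v \<in> specht_module ?\<mu>'"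
    "\<And>\<sigma> v. \<phi> (conv ?G (indicator {\<sigma>}) v) = fscale (of_int (sign \<sigma>)) (conv ?G (indicator {\<sigma>}) (\<phi> v))"
    using specht_conj_twist[OF assms] by metis
  have basis: "basis_list (map \<phi> (specht_basis \<mu>)) (specht_module ?\<mu>')"
    using basis_list_map[OF specht_basis specht_basis _ \<phi>(1-3)] irrep_dim_conj[OF assms]
    by (simp add: irrep_dim_eq)
  have inv: "v \<in> specht_module \<mu> \<Longrightarrow> ?T v \<in> specht_module \<mu>"
    "v \<in> specht_module ?\<mu>' \<Longrightarrow> ?T v \<in> specht_module ?\<mu>'" for v
    using specht_module_left_ideal[of v \<mu>] specht_module_left_ideal[of v ?\<mu>'] n by auto
  have "mat_of (map \<phi> (specht_basis \<mu>)) (map \<phi> (specht_basis \<mu>)) ?T =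
      of_int (sign \<sigma>) \<cdot>\<^sub>m mat_of (specht_basis \<mu>) (specht_basis \<mu>) ?T"
  proof (rule mat_of_map[OF specht_basis basis \<phi>(1,3) inv(1)])
    fix v
    have "(of_int (sign \<sigma>) :: complex) * of_int (sign \<sigma>) = 1"
      by (simp add: sign_idempotent flip: of_int_mult)
    then show "?T (\<phi> v) = fscale (of_int (sign \<sigma>)) (\<phi> (?T v))"
      unfolding \<phi>(4) galg.scale_scale by simp
  qed
  moreover have "mat_trace (c \<cdot>\<^sub>m mat_of bs bs T) = c * mat_trace (mat_of bs bs T)"
    for c T and bs :: "((nat \<Rightarrow> nat) \<Rightarrow> complex) list"
    by (simp add: mat_trace_eq mat_of_def sum_distrib_left)
  ultimately show ?thesis
    using mat_trace_basis_change[OF basis specht_basis linear_conv_right inv(2)] n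
    by (simp add: irrep_char_eq irrep_eq)
qed

lemma irrep_g_conj:
  assumes "\<mu> \<in> partitions_of n" "n \<ge> 2"
  shows "irrep_g (conj_partition \<mu>) = of_nat (irrep_dim \<mu>) - irrep_g \<mu>"
proof -
  have "sum_list \<mu> = n" "sum_list (conj_partition \<mu>) = n"
    using assms conj_partition_in[OF assms(1)] by (auto simp: partitions_of_def)
  then show ?thesis using assms
    by (simp add: irrep_g_def irrep_dim_conj irrep_char_conj sign_swap_id field_simps)
qed

subsection \<open>Counting by parity\<close>

text \<open>The value of \<open>irrep_g\<close> as a natural number, hence determined despite the
  choice.\<close>

definition neg_mult :: "nat list \<Rightarrow> nat"
  where "neg_mult \<mu> = (SOME k. k \<le> irrep_dim \<mu> \<and> irrep_g \<mu> = of_nat k \<and> (chiral \<mu> \<longleftrightarrow> odd k))"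

lemma neg_mult:
  "neg_mult \<mu> \<le> irrep_dim \<mu>" "irrep_g \<mu> = of_nat (neg_mult \<mu>)" "chiral \<mu> \<longleftrightarrow> odd (neg_mult \<mu>)"
proof -
  have "\<exists>k. k \<le> irrep_dim \<mu> \<and> irrep_g \<mu> = of_nat k \<and> (chiral \<mu> \<longleftrightarrow> odd k)"
    using irrep_g_nat by metis
  from someI_ex[OF this] show "neg_mult \<mu> \<le> irrep_dim \<mu>" "irrep_g \<mu> = of_nat (neg_mult \<mu>)"
    "chiral \<mu> \<longleftrightarrow> odd (neg_mult \<mu>)" unfolding neg_mult_def by blast+
qed

lemma neg_mult_conj:
  assumes "\<mu> \<in> partitions_of n" "n \<ge> 2"
  shows "neg_mult (conj_partition \<mu>) + neg_mult \<mu> = irrep_dim \<mu>"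
proof -
  have "of_nat (neg_mult (conj_partition \<mu>) + neg_mult \<mu>) = (of_nat (irrep_dim \<mu>) :: complex)"
    using irrep_g_conj[OF assms] by (simp add: neg_mult(2))
  then show ?thesis by (simp only: of_nat_eq_iff)
qed

lemma finite_partitions_of [simp]: "finite (partitions_of n)"
proof (rule finite_subset)
  have "length \<mu> \<le> sum_list \<mu>" if "\<forall>p\<in>set \<mu>. p > 0" for \<mu> :: "nat list"
    using that by (induction \<mu>) (auto simp: Suc_le_eq intro: le_less_trans)
  then show "partitions_of n \<subseteq> {\<mu>. set \<mu> \<subseteq> {..n} \<and> length \<mu> \<le> n}"
    by (auto simp: partitions_of_def member_le_sum_list)
qed (simp add: finite_lists_length_le)

text \<open>By \<open>neg_mult_conj\<close>, conjugation flips the parity of \<open>neg_mult\<close>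
  when the dimension is odd, so it pairs the partitions counted here with the other odd-dimensional
  ones.\<close>

lemma card_odd_conj:
  assumes "n \<ge> 2"
  shows "2 * card {\<mu> \<in> partitions_of n. odd (irrep_dim \<mu>) \<and> odd (neg_mult \<mu>)} = num_odd n"
proof -
  let ?X = "\<lambda>P. {\<mu> \<in> partitions_of n. odd (irrep_dim \<mu>) \<and> P (neg_mult \<mu>)}"
  have flip: "even (neg_mult (conj_partition \<mu>)) \<longleftrightarrow> odd (neg_mult \<mu>)"
    if "\<mu> \<in> partitions_of n" "odd (irrep_dim \<mu>)" for \<mu>
    using neg_mult_conj[OF that(1) assms] that(2) by (metis even_add)
  have "bij_betw conj_partition (?X odd) (?X even)"
    by (rule bij_betwI[where g = conj_partition])
       (auto simp: conj_partition_in irrep_dim_conj conj_partition_conj flip)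
  then have "card (?X odd) = card (?X even)" by (rule bij_betw_same_card)
  moreover have "num_odd n = card (?X odd \<union> ?X even)"
    unfolding num_odd_def by (intro arg_cong[of _ _ card]) auto
  moreover have "\<dots> = card (?X odd) + card (?X even)"
    by (intro card_Un_disjoint) auto
  ultimately show ?thesis by simp
qed

lemma num_chiral_split:
  "num_chiral n = card {\<mu> \<in> partitions_of n. even (irrep_dim \<mu>) \<and> odd (neg_mult \<mu>)} +
    card {\<mu> \<in> partitions_of n. odd (irrep_dim \<mu>) \<and> odd (neg_mult \<mu>)}"
  unfolding num_chiral_def neg_mult(3)
  by (subst card_Un_disjoint[symmetric]) (auto intro!: arg_cong[of _ _ card])

section \<open>Counting tuples entry by entry\<close>

definition tuples :: "nat \<Rightarrow> (nat \<Rightarrow> 'a set) \<Rightarrow> 'a list set"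
  where "tuples r Q = {ls. length ls = r \<and> (\<forall>k<r. ls ! k \<in> Q k)}"

lemma tuples_Suc: "tuples (Suc r) Q = (\<lambda>(ls, x). ls @ [x]) ` (tuples r Q \<times> Q r)"
proof (intro Set.set_eqI iffI)
  fix ls assume ls: "ls \<in> tuples (Suc r) Q"
  then have "ls \<noteq> []" by (auto simp: tuples_def)
  then have "ls = butlast ls @ [last ls]" by simp
  moreover have "butlast ls \<in> tuples r Q" "last ls \<in> Q r"
    using ls \<open>ls \<noteq> []\<close> by (auto simp: tuples_def nth_butlast last_conv_nth)
  ultimately show "ls \<in> (\<lambda>(ls, x). ls @ [x]) ` (tuples r Q \<times> Q r)"
    by (intro image_eqI[of _ _ "(butlast ls, last ls)"]) auto
qed (auto simp: tuples_def nth_append less_Suc_eq)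

lemma card_tuples: "card (tuples r Q) = (\<Prod>k<r. card (Q k))"
proof (induction r)
  case (Suc r)
  have "inj_on (\<lambda>(ls, x). ls @ [x]) (tuples r Q \<times> Q r)" by (auto intro: inj_onI)
  then show ?case using Suc by (simp add: tuples_Suc card_image card_cartesian_product)
qed (simp add: tuples_def)

lemma finite_tuples: "(\<And>k. k < r \<Longrightarrow> finite (Q k)) \<Longrightarrow> finite (tuples r Q)"
  by (induction r) (auto simp: tuples_Suc, simp add: tuples_def)

section \<open>Integrality of multinomial coefficients and of M\<close>

lemma prod_fact_dvd_fact_sum:
  "finite S \<Longrightarrow> (\<Prod>k\<in>S. fact (b k)) dvd (fact (\<Sum>k\<in>S. b k) :: nat)"
proof (induction S rule: finite_induct)
  case (insert x S)
  have "fact (b x) * (\<Prod>k\<in>S. fact (b k)) dvd fact (b x) * (fact (\<Sum>k\<in>S. b k) :: nat)"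
    using insert by (intro mult_dvd_mono) auto
  also have "\<dots> dvd fact (b x + (\<Sum>k\<in>S. b k))" by (rule fact_fact_dvd_fact)
  finally show ?case using insert by simp
qed simp

text \<open>The factor \<open>a i * a j\<close> lowers two factorials in the denominator by one step
  each, leaving a genuine multinomial coefficient with upper entry two less than the sum.\<close>

lemma fact_quotient_mult_entries_integral:
  fixes a :: "nat \<Rightarrow> nat"
  assumes "i < r" "j < r" "i \<noteq> j"
  obtains t :: nat where
    "fact ((\<Sum>k<r. a k) - 2) * (a i * a j) = t * (\<Prod>k<r. fact (a k))"
proof (cases "a i = 0 \<or> a j = 0")
  case True
  then show thesis using that[of 0] by auto
next
  case False
  define b where "b k = (if k = i \<or> k = j then a k - 1 else a k)" for k
  \<comment> \<open>Both entries are positive here, so the subtraction of 2 is exact.\<close>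
  have "(\<Sum>k<r. a k) = (\<Sum>k<r. b k + ((if k = i then 1 else 0) + (if k = j then 1 else 0)))"
    using False assms by (intro sum.cong) (auto simp: b_def)
  also have "\<dots> = (\<Sum>k<r. b k) + 2" using assms by (simp add: sum.distrib)
  finally have sum: "(\<Sum>k<r. b k) = (\<Sum>k<r. a k) - 2" by simp
  have "(\<Prod>k<r. fact (a k)) = (\<Prod>k<r. (fact (b k) :: nat) * ((if k = i then a k else 1) * (if k = j then a k else 1)))"
    using False assms by (intro prod.cong) (auto simp: b_def fact_reduce)
  also have "\<dots> = (\<Prod>k<r. fact (b k)) * (a i * a j)"
    using assms by (simp add: prod.distrib)
  finally have prod: "(\<Prod>k<r. fact (a k)) = (\<Prod>k<r. fact (b k)) * (a i * a j)" .
  obtain t :: nat where "fact (\<Sum>k<r. b k) = (\<Prod>k<r. fact (b k)) * t"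
    using prod_fact_dvd_fact_sum[of "{..<r}" b] by (auto elim: dvdE)
  then show thesis using that[of t] by (simp add: prod flip: sum)
qed

text \<open>One integer serves two fields at once, because M is stated over the rationals while
  \<open>coeff_M\<close> is complex.\<close>

lemma coeff_M_integral:
  fixes a :: "nat \<Rightarrow> nat"
  obtains z :: int where
"fact ((\<Sum>k<r. a k) - 2) / (\<Prod>k<r. fact (a k)) *
      (\<Sum>(i, j) \<in> {(i, j). i < j \<and> j < r}. of_nat (a i) * of_nat (a j)) = (of_int z :: 'a :: field_char_0)"
    "fact ((\<Sum>k<r. a k) - 2) / (\<Prod>k<r. fact (a k)) *
      (\<Sum>(i, j) \<in> {(i, j). i < j \<and> j < r}. of_nat (a i) * of_nat (a j)) = (of_int z :: 'b :: field_char_0)"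
proof -
  have "\<exists>t :: nat. fact ((\<Sum>k<r. a k) - 2) * (a i * a j) = t * (\<Prod>k<r. fact (a k))"
    if "i < j" "j < r" for i j
    using fact_quotient_mult_entries_integral[of i r j a] that by auto
  then obtain t :: "nat \<Rightarrow> nat \<Rightarrow> nat" where
    t: "fact ((\<Sum>k<r. a k) - 2) * (a i * a j) = t i j * (\<Prod>k<r. fact (a k))" if "i < j" "j < r" for i j
    by metis
  have *: "fact ((\<Sum>k<r. a k) - 2) / (\<Prod>k<r. fact (a k)) *
      (\<Sum>(i, j) \<in> {(i, j). i < j \<and> j < r}. of_nat (a i) * of_nat (a j)) =
      (of_int (\<Sum>(i, j) \<in> {(i, j). i < j \<and> j < r}. int (t i j)) :: 'c :: field_char_0)"
  proof -
    have nz: "(\<Prod>k<r. fact (a k) :: 'c) \<noteq> 0" by simp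
    have "fact ((\<Sum>k<r. a k) - 2) / (\<Prod>k<r. fact (a k)) * (of_nat (a i) * of_nat (a j)) = (of_nat (t i j) :: 'c)"
      if "i < j" "j < r" for i j
    proof -
      have "of_nat (fact ((\<Sum>k<r. a k) - 2) * (a i * a j)) = (of_nat (t i j * (\<Prod>k<r. fact (a k))) :: 'c)"
        using t[OF that] by simp
      then show ?thesis using nz by (simp add: field_simps)
    qed
    then show ?thesis
      unfolding sum_distrib_left of_int_sum by (intro sum.cong refl) auto
  qed
  show thesis
    by (rule that[of "\<Sum>(i, j) \<in> {(i, j). i < j \<and> j < r}. int (t i j)"]) (rule *)+
qed

text \<open>Modulo 2, the leave-one-out product at \<open>k\<close> survives only if all other
  factors are odd. Thus no even factor keeps everything, one even factor keeps only its own term,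
  and two leave nothing.\<close>

lemma odd_leave_one_out_sum:
  fixes F g c :: "nat \<Rightarrow> int" and M :: int and r :: nat
  defines "Y \<equiv> (\<Prod>k<r. F k) * M + (\<Sum>k<r. g k * (\<Prod>j\<in>{..<r} - {k}. F j) * c k)"
  shows "(\<forall>k<r. odd (F k)) \<Longrightarrow> odd Y \<longleftrightarrow> odd (M + (\<Sum>k<r. g k * c k))"
    and "\<lbrakk>i < r; even (F i); \<forall>k<r. k \<noteq> i \<longrightarrow> odd (F k)\<rbrakk> \<Longrightarrow> odd Y \<longleftrightarrow> odd (g i * c i)"
    and "\<lbrakk>i < r; even (F i); j < r; even (F j); i \<noteq> j\<rbrakk> \<Longrightarrow> even Y"
proof -
  have ev: "even (\<Prod>k\<in>S. F k)" if "finite S" "i \<in> S" "even (F i)" for S i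
    using that by (meson dvd_prod_eqI dvd_trans dvd_prodI)
  have od: "odd (\<Prod>k\<in>S. F k)" if "\<forall>k\<in>S. odd (F k)" for S
    using that by (induction S rule: infinite_finite_induct) auto
  {
    assume odd: "\<forall>k<r. odd (F k)"
    have "even ((\<Sum>k<r. g k * (\<Prod>j\<in>{..<r} - {k}. F j) * c k) - (\<Sum>k<r. g k * c k))"
      unfolding sum_subtractf[symmetric]
    proof (intro dvd_sum)
      fix k assume "k \<in> {..<r}"
      have "odd (\<Prod>j\<in>{..<r} - {k}. F j)" using odd by (intro od) auto
      then show "even (g k * (\<Prod>j\<in>{..<r} - {k}. F j) * c k - g k * c k)" by simp
    qed
    moreover have "odd (\<Prod>k<r. F k)" using odd by (intro od) auto
    ultimately show "odd Y \<longleftrightarrow> odd (M + (\<Sum>k<r. g k * c k))" by (simp add: Y_def)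
  next
    assume i: "i < r" "even (F i)" and odd: "\<forall>k<r. k \<noteq> i \<longrightarrow> odd (F k)"
    have "even (\<Sum>k\<in>{..<r} - {i}. g k * (\<Prod>j\<in>{..<r} - {k}. F j) * c k)"
    proof (intro dvd_sum)
      fix k assume "k \<in> {..<r} - {i}"
      then have "even (\<Prod>j\<in>{..<r} - {k}. F j)" using i by (intro ev[of _ i]) auto
      then show "even (g k * (\<Prod>j\<in>{..<r} - {k}. F j) * c k)" by simp
    qed
    moreover have "(\<Sum>k<r. g k * (\<Prod>j\<in>{..<r} - {k}. F j) * c k) = g i * (\<Prod>j\<in>{..<r} - {i}. F j) * c i +
        (\<Sum>k\<in>{..<r} - {i}. g k * (\<Prod>j\<in>{..<r} - {k}. F j) * c k)"
      using i by (intro sum.remove) auto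
    moreover have "odd (\<Prod>j\<in>{..<r} - {i}. F j)" using odd by (intro od) auto
    moreover have "even (\<Prod>k<r. F k)" using i by (intro ev[of _ i]) auto
    ultimately show "odd Y \<longleftrightarrow> odd (g i * c i)" by (simp add: Y_def)
  next
    assume ij: "i < r" "even (F i)" "j < r" "even (F j)" "i \<noteq> j"
    have "even (\<Sum>k<r. g k * (\<Prod>j\<in>{..<r} - {k}. F j) * c k)"
    proof (intro dvd_sum)
      fix k assume "k \<in> {..<r}"
      have "even (\<Prod>j\<in>{..<r} - {k}. F j)"
        using ij by (cases "k = i") (auto intro: ev[of _ i] ev[of _ j])
      then show "even (g k * (\<Prod>j\<in>{..<r} - {k}. F j) * c k)" by simp
    qed
    moreover have "even (\<Prod>k<r. F k)" using ij by (intro ev[of _ i]) auto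
    ultimately show "even Y" by (simp add: Y_def)
  }
qed

lemma is_odd_of_int: "is_odd (of_int k :: 'a :: ring_char_0) \<longleftrightarrow> odd k"
  by (auto simp: is_odd_def)

lemma is_even_of_int: "is_even (of_int k :: 'a :: ring_char_0) \<longleftrightarrow> even k"
  by (auto simp: is_even_def)

text \<open>A negative lower entry makes the coefficient 0. Hence positions in \<open>I\<close>
  carry sizes at least 2, where conjugation halves the odd-dimensional partitions.\<close>

lemma odd_lowered_multinomial:
  assumes "k < length a" "odd (lowered_multinomial a k)"
  shows "a ! k \<ge> 2"
proof (rule ccontr)
  assume "\<not> a ! k \<ge> 2"
  then have "int (a ! k) - 2 < 0" by simp
  moreover have "int (a ! k) - 2 \<in> set ((map int a)[k := int (a ! k) - 2])"
    using assms(1) by (simp add: set_update_memI)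
  ultimately have "\<exists>x\<in>set ((map int a)[k := int (a ! k) - 2]). x < 0" by (rule bexI)
  then have "lowered_multinomial a k = 0"
    unfolding lowered_multinomial_def multinomial_def by (rule if_P)
  then show False using assms(2) by simp
qed

section \<open>Sorting the tuples by the positions of even dimensions\<close>

theorem proposition8:
  fixes n r m :: nat and a :: "nat list" and M :: rat and I :: "nat set"
  assumes "n \<ge> 2" and "r \<ge> 1"
    and "length a = r" and "sorted_wrt (\<ge>) a" and "sum_list a = n"
    and "M = fact (n - 2) / (\<Prod>k<r. fact (a ! k)) *
          (\<Sum>(i, j) \<in> {(i, j). i < j \<and> j < r}. of_nat (a ! i) * of_nat (a ! j))"
    and "I = {i \<in> {..<r}. odd (multinomial (n - 2) ((map int a)[i := int (a ! i) - 2]))}"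
    and "m = card I"
  shows "(I = {} \<longrightarrow>
            (is_odd M \<longrightarrow> num_y_odd a = (\<Prod>k<r. num_odd (a ! k))) \<and>
            (is_even M \<longrightarrow> num_y_odd a = 0)) \<and>
         (m \<ge> 1 \<longrightarrow>
            (of_nat (num_y_odd a) :: rat) =
              (\<Sum>i\<in>I. of_nat (num_chiral (a ! i)) *
                 (\<Prod>k\<in>{..<r} - {i}. of_nat (num_odd (a ! k)))) -
              (of_nat m - 1) / 2 * (\<Prod>k<r. of_nat (num_odd (a ! k))))"
proof -
  define c where "c k = int (lowered_multinomial a k)" for k
  have I: "I = {i. i < r \<and> odd (c i)}"
    using assms(5,7) by (auto simp: c_def lowered_multinomial_def)
  have finI: "finite I" by (simp add: I)
  have I2: "a ! i \<ge> 2" if "i \<in> I" for i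
    using odd_lowered_multinomial[of i a] that assms(3) by (simp add: I c_def)
  have sum_a: "(\<Sum>k<r. a ! k) = n"
    using assms(3,5) by (simp add: sum_list_sum_nth atLeast0LessThan)
  obtain z where
    z: "fact (n - 2) / (\<Prod>k<r. fact (a ! k)) *
      (\<Sum>(i, j) \<in> {(i, j). i < j \<and> j < r}. of_nat (a ! i) * of_nat (a ! j)) = (of_int z :: rat)"
      "fact (n - 2) / (\<Prod>k<r. fact (a ! k)) *
      (\<Sum>(i, j) \<in> {(i, j). i < j \<and> j < r}. of_nat (a ! i) * of_nat (a ! j)) = (of_int z :: complex)"
    by (rule coeff_M_integral[where r = r and a = "(!) a" and 'a = rat and 'b = complex, unfolded sum_a])
  have M: "M = of_int z" using assms(6) z(1) by (rule trans)
  have coeff: "coeff_M a = of_int z" unfolding coeff_M_def assms(3,5) by (rule z(2))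

  define T where "T Q = tuples r (\<lambda>k. {\<mu> \<in> partitions_of (a ! k). Q k \<mu>})" for Q
  have finT: "finite (T Q)" for Q unfolding T_def by (rule finite_tuples) simp
  have T_iff: "ls \<in> T Q \<longleftrightarrow> length ls = r \<and> (\<forall>k<r. ls ! k \<in> partitions_of (a ! k) \<and> Q k (ls ! k))"
    for ls Q by (auto simp: T_def tuples_def)
  \<comment> \<open>\<open>N\<close> has the parity of \<open>Y\<close> below when all dimensions
    are odd; \<open>O1\<close> collects those tuples with odd value, and \<open>E i\<close> those
    whose only even dimension is at \<open>i\<close>, with \<open>neg_mult\<close> odd
    there.\<close>
  define N where "N ls = z + (\<Sum>k<r. int (neg_mult (ls ! k)) * c k)" for ls
  define odds where "odds = T (\<lambda>k \<mu>. odd (irrep_dim \<mu>))"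
  define O1 where "O1 = {ls \<in> odds. odd (N ls)}"
  define E where "E i = T (\<lambda>k \<mu>. if k = i then even (irrep_dim \<mu>) \<and> odd (neg_mult \<mu>) else odd (irrep_dim \<mu>))" for i
  define Y where "Y ls = (\<Prod>k<r. int (irrep_dim (ls ! k))) * z +
    (\<Sum>k<r. int (neg_mult (ls ! k)) * (\<Prod>j\<in>{..<r} - {k}. int (irrep_dim (ls ! j))) * c k)" for ls
  have y: "y_val a ls = of_int (Y ls)" for ls
    using assms(3) by (simp add: y_val_def Y_def coeff neg_mult(2) c_def)
  note parity = odd_leave_one_out_sum[where r = r and F = "\<lambda>k. int (irrep_dim (ls ! k))"
      and g = "\<lambda>k. int (neg_mult (ls ! k))" and c = c and M = z for ls, folded Y_def]

  have S_iff: "ls \<in> T (\<lambda>_ _. True) \<and> odd (Y ls) \<longleftrightarrow> ls \<in> O1 \<or> (\<exists>i\<in>I. ls \<in> E i)" (is "?l \<longleftrightarrow> ?r") for ls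
  proof (cases "\<forall>k<r. odd (irrep_dim (ls ! k))")
    case True
    then have "odd (Y ls) \<longleftrightarrow> odd (N ls)" using parity(1)[of ls] by (simp add: N_def)
    moreover have "ls \<notin> E i" if "i \<in> I" for i using True that by (auto simp: E_def T_iff I)
    ultimately show ?thesis using True by (auto simp: O1_def odds_def T_iff)
  next
    case False
    then obtain i where i: "i < r" "even (irrep_dim (ls ! i))" by blast
    then have O1: "ls \<notin> O1" by (auto simp: O1_def odds_def T_iff)
    show ?thesis
    proof (cases "\<forall>k<r. k \<noteq> i \<longrightarrow> odd (irrep_dim (ls ! k))")
      case True
      \<comment> \<open>Outside \<open>I\<close> the coefficient \<open>c i\<close> is even, which
        matches the absence of \<open>E i\<close> from the union.\<close>
      then have "odd (Y ls) \<longleftrightarrow> odd (int (neg_mult (ls ! i)) * c i)"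
        using i parity(2)[of i ls] by simp
      moreover have "ls \<in> E j \<longleftrightarrow> j = i \<and> ls \<in> T (\<lambda>_ _. True) \<and> odd (neg_mult (ls ! i))" if "j \<in> I" for j
        using True i that by (auto simp: E_def T_iff I)
      ultimately show ?thesis using O1 i by (auto simp: I)
    next
      case False
      then obtain j where j: "j < r" "j \<noteq> i" "even (irrep_dim (ls ! j))" by blast
      then have "even (Y ls)" using i parity(3)[of i ls j] by auto
      moreover have "ls \<notin> E k" for k
      proof
        assume "ls \<in> E k"
        then have "x = k" if "x < r" "even (irrep_dim (ls ! x))" for x
          using that by (auto simp: E_def T_iff split: if_splits)
        then show False using i j by metis
      qed
      ultimately show ?thesis using O1 by blast
    qed
  qed
  have fin: "finite O1" "finite (E i)" for i
    using finT by (simp_all add: O1_def odds_def E_def)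
  have disj: "O1 \<inter> (\<Union>i\<in>I. E i) = {}"
    by (auto simp: O1_def odds_def E_def T_iff I)
  have "num_y_odd a = card (O1 \<union> (\<Union>i\<in>I. E i))"
    unfolding num_y_odd_def
    by (rule arg_cong[of _ _ card], rule Set.set_eqI)
       (use S_iff assms(3) in \<open>auto simp: y is_odd_of_int T_iff\<close>)
  also have "\<dots> = card O1 + card (\<Union>i\<in>I. E i)"
    using finI fin disj by (intro card_Un_disjoint) auto
  \<comment> \<open>The position of the single even dimension tells the sets \<open>E i\<close>
    apart.\<close>
  also have "card (\<Union>i\<in>I. E i) = (\<Sum>i\<in>I. card (E i))"
    using finI fin by (intro card_UN_disjoint) (auto simp: E_def T_iff I split: if_splits)
  finally have num: "num_y_odd a = card O1 + (\<Sum>i\<in>I. card (E i))" .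

  have odds_card: "card odds = (\<Prod>k<r. num_odd (a ! k))"
    by (simp add: odds_def T_def card_tuples num_odd_def)

  show ?thesis
  proof (intro conjI impI)
    assume "I = {}"
    then have "even (c k)" if "k < r" for k using that by (auto simp: I)
    \<comment> \<open>With all coefficients even, the parity of \<open>N\<close> is that of
      \<open>z\<close>, the same for every tuple.\<close>
    then have "even (\<Sum>k<r. int (neg_mult (ls ! k)) * c k)" for ls by (intro dvd_sum) simp
    then have "odd (N ls) \<longleftrightarrow> odd z" for ls by (simp add: N_def)
    then have "O1 = (if odd z then odds else {})" by (auto simp: O1_def)
    then have "num_y_odd a = (if odd z then card odds else 0)" using num \<open>I = {}\<close> by simp
    then show "is_odd M \<Longrightarrow> num_y_odd a = (\<Prod>k<r. num_odd (a ! k))"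
      "is_even M \<Longrightarrow> num_y_odd a = 0"
      by (simp_all add: M is_odd_of_int is_even_of_int odds_card)
  next
    assume "m \<ge> 1"
    then obtain i where i: "i \<in> I" using assms(8) by fastforce
    then have ir: "i < r" by (simp add: I)
    \<comment> \<open>Conjugating only the entry at \<open>i\<close> is an involution on
      \<open>odds\<close>; it changes the parity of \<open>N\<close> because \<open>c i\<close> is
      odd and the size at \<open>i\<close> is at least 2.\<close>
    define h where "h ls = ls[i := conj_partition (ls ! i)]" for ls :: "nat list list"
    have h: "h ls \<in> odds" "h (h ls) = ls" "odd (N (h ls)) \<longleftrightarrow> even (N ls)" if ls: "ls \<in> odds" for ls
    proof -
      have part: "ls ! k \<in> partitions_of (a ! k)" and odd: "odd (irrep_dim (ls ! k))" if "k < r" for k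
        using ls that by (auto simp: odds_def T_iff)
      have len: "length ls = r" using ls by (simp add: odds_def T_iff)
      show "h ls \<in> odds" using part odd len ir
        by (auto simp: odds_def T_iff h_def nth_list_update conj_partition_in irrep_dim_conj[OF part])
      show "h (h ls) = ls"
        using len ir conj_partition_conj[OF part[OF ir]] by (simp add: h_def)
      have split: "N xs = z + int (neg_mult (xs ! i)) * c i +
          (\<Sum>k\<in>{..<r} - {i}. int (neg_mult (xs ! k)) * c k)" for xs
        unfolding N_def using ir by (subst sum.remove[of _ i]) auto
      have "(\<Sum>k\<in>{..<r} - {i}. int (neg_mult (h ls ! k)) * c k) =
          (\<Sum>k\<in>{..<r} - {i}. int (neg_mult (ls ! k)) * c k)"
        by (intro sum.cong refl) (auto simp: h_def)
      moreover have "neg_mult (h ls ! i) + neg_mult (ls ! i) = irrep_dim (ls ! i)"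
        using neg_mult_conj[OF part[OF ir] I2[OF i]] len ir by (simp add: h_def)
      then have "odd (neg_mult (h ls ! i)) \<longleftrightarrow> even (neg_mult (ls ! i))"
        using odd[OF ir] by (metis even_add)
      moreover have "odd (c i)" using i by (simp add: I)
      ultimately show "odd (N (h ls)) \<longleftrightarrow> even (N ls)"
        unfolding split[of "h ls"] split[of ls] by auto
    qed
    have "bij_betw h O1 (odds - O1)"
      by (rule bij_betwI[where g = h]) (auto simp: O1_def h)
    then have "card O1 = card (odds - O1)" by (rule bij_betw_same_card)
    moreover have "card (odds - O1) = card odds - card O1" "card O1 \<le> card odds"
      using finT by (auto simp: O1_def odds_def card_Diff_subset card_mono)
    ultimately have O1_card: "2 * card O1 = card odds" by simp

    let ?A = "\<lambda>k. of_nat (num_odd (a ! k)) :: rat"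
    have E_card: "of_nat (card (E i)) = of_nat (num_chiral (a ! i)) * (\<Prod>k\<in>{..<r} - {i}. ?A k) -
        (\<Prod>k<r. ?A k) / 2" if i: "i \<in> I" for i
    proof -
      let ?e = "card {\<mu> \<in> partitions_of (a ! i). even (irrep_dim \<mu>) \<and> odd (neg_mult \<mu>)}"
      have ir: "i < r" using i by (simp add: I)
      have "card (E i) = ?e * (\<Prod>k\<in>{..<r} - {i}. num_odd (a ! k))"
        unfolding E_def T_def card_tuples using ir
        by (subst prod.remove[of _ i]) (auto simp: num_odd_def intro!: prod.cong)
      \<comment> \<open>Chiral partitions of odd dimension make up half of \<open>num_odd\<close>;
        removing them leaves the even-dimensional ones needed at position \<open>i\<close>.\<close>
      moreover have "2 * num_chiral (a ! i) = 2 * ?e + num_odd (a ! i)"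
        using card_odd_conj[OF I2[OF i]] num_chiral_split[of "a ! i"] by simp
      then have "of_nat (2 * num_chiral (a ! i)) = (of_nat (2 * ?e + num_odd (a ! i)) :: rat)"
        by (rule arg_cong)
      then have "of_nat (num_chiral (a ! i)) = (of_nat ?e + ?A i / 2 :: rat)" by simp
      moreover have "(\<Prod>k<r. ?A k) = ?A i * (\<Prod>k\<in>{..<r} - {i}. ?A k)"
        using ir by (intro prod.remove) auto
      ultimately show ?thesis by (simp add: algebra_simps)
    qed
    \<comment> \<open>With P the product of all \<open>?A k\<close>, the set \<open>O1\<close>
      contributes P/2 and the corrections in the \<open>E i\<close> sum to -m P/2, which together
      give the coefficient -(m - 1)/2.\<close>
    have "of_nat (2 * card O1) = (\<Prod>k<r. ?A k)"
      unfolding O1_card odds_card by simp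
    moreover have "(\<Sum>i\<in>I. of_nat (card (E i))) =
        (\<Sum>i\<in>I. of_nat (num_chiral (a ! i)) * (\<Prod>k\<in>{..<r} - {i}. ?A k)) -
        of_nat m * ((\<Prod>k<r. ?A k) / 2)"
      by (simp add: E_card sum_subtractf assms(8))
    ultimately show "(of_nat (num_y_odd a) :: rat) =
        (\<Sum>i\<in>I. of_nat (num_chiral (a ! i)) * (\<Prod>k\<in>{..<r} - {i}. ?A k)) -
        (of_nat m - 1) / 2 * (\<Prod>k<r. ?A k)"
      unfolding num of_nat_add of_nat_sum by (simp add: field_simps)
  qed
qed

end
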